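(* Let $F\in\mathbb{R}[x,y,t,s]$ be square-free, with no factor depending only on $(t,s)$, and such that the leading coefficient of $F$ with respect to $y$ does not depend on $x$. Let $M(x,t,s)=\sqrt{D_y(F)}$ and $R(t,s)=D_x(M)$, and assume $R$ is not identically zero. Let $\mathcal{R}=\{(t,s)\in\mathbb{R}^2: R(t,s)=0\}$ and let $\mathcal{L}_1,\dots,\mathcal{L}_p$ be the connected components of $\mathbb{R}^2\setminus\mathcal{R}$. Then for each $i$, the topology type of the curve $F(x,y,t,s)=0$ stays invariant as $(t,s)$ ranges over $\mathcal{L}_i$.
   Context: For a polynomial $G$ and a variable $w$, $D_w(G):=\mathrm{Res}_w(G,\partial G/\partial w)$, and $\sqrt{G}$ denotes the square-free part of $G$. By convention $M:=0$ if $\deg_y F=0$ and $R:=0$ if $\deg_x M=0$. Two real plane curves have the same topology type if there is a homeomorphism of $\mathbb{R}^2$ onto itself mapping the real zero set of one onto the real zero set of the other. *)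

theory Defs
  imports "HOL-Analysis.Analysis" "HOL-Computational_Algebra.Computational_Algebra" "HOL-Computational_Algebra.Field_as_Ring"
    "Subresultants.Resultant_Prelim"
begin

text \<open>Polynomials in R[x,y,t,s] are encoded as nested univariate polynomials:
  type real poly poly poly poly = polynomials in y over polynomials in x over
  polynomials in t over polynomials in s.  Similarly real poly poly poly is R[x,t,s]
  (x outermost) and real poly poly is R[t,s] (t outermost).\<close>

definition Dres :: "'a::idom poly \<Rightarrow> 'a" where
  "Dres G = resultant G (pderiv G)"

definition sqfree_part :: "'a::factorial_semiring \<Rightarrow> 'a" where
  "sqfree_part G = (if G = 0 then 0 else \<Prod>(prime_factors G))"

definition M_of :: "real poly poly poly poly \<Rightarrow> real poly poly poly" where
  "M_of F = (if degree F = 0 then 0 else sqfree_part (Dres F))"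

definition R_of :: "real poly poly poly poly \<Rightarrow> real poly poly" where
  "R_of F = (let M = M_of F in if degree M = 0 then 0 else Dres M)"

definition eval_ts :: "real poly poly \<Rightarrow> real \<Rightarrow> real \<Rightarrow> real" where
  "eval_ts P t s = poly (poly P [:t:]) s"

definition eval_xyts :: "real poly poly poly poly \<Rightarrow> real \<Rightarrow> real \<Rightarrow> real \<Rightarrow> real \<Rightarrow> real" where
  "eval_xyts F x y t s = poly (poly (poly (poly F [:[:[:y:]:]:]) [:[:x:]:]) [:t:]) s"

definition curve :: "real poly poly poly poly \<Rightarrow> real \<Rightarrow> real \<Rightarrow> (real \<times> real) set" where
  "curve F t s = {(x, y). eval_xyts F x y t s = 0}"

definition same_topology_type :: "(real \<times> real) set \<Rightarrow> (real \<times> real) set \<Rightarrow> bool" where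
  "same_topology_type A B \<longleftrightarrow>
     (\<exists>h h'. homeomorphism UNIV UNIV h h' \<and> h ` A = B)"

definition only_ts :: "real poly poly poly poly \<Rightarrow> bool" where
  "only_ts G \<longleftrightarrow> degree G = 0 \<and> degree (coeff G 0) = 0"

end

theory Submission
  imports Defs "HOL-Complex_Analysis.Complex_Analysis" "Jordan_Normal_Form.Determinant"
begin

text \<open>If \<open>R(t,s) \<noteq> 0\<close>, then \<open>M\<close> has simple complex roots at \<open>(t,s)\<close>, and over a complex \<open>x\<close>
  that is not one of them the roots of \<open>F\<close> in \<open>y\<close> are simple. So the real critical values of \<open>x\<close>
  and, away from them, the real roots \<open>y\<close> move continuously with \<open>(t,s)\<close> and keep their order.

  The point is that the roots over a critical value \<open>b\<close> do not split when \<open>(t,s)\<close> moves. The roots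
  over a circle around \<open>b\<close> are separated by some \<open>c > 0\<close>, uniformly in \<open>(t,s)\<close>. In a logarithmic
  coordinate two roots over the punctured disc are holomorphic functions \<open>Y\<^sub>1, Y\<^sub>2\<close> on a half-plane,
  and if they have different limits over \<open>b\<close> then \<open>1 / (Y\<^sub>1 - Y\<^sub>2)\<close> is bounded; by
  Phragmen-Lindelof its bound \<open>1 / c\<close> on the circle holds throughout, so distinct roots over \<open>b\<close>
  are at distance at least \<open>c\<close>, whereas split roots would be arbitrarily close.

  Hence roots that merge over \<open>b\<close> do so for all nearby \<open>(t,s)\<close>, and piecewise linear maps in \<open>x\<close>
  and along the vertical lines matching roots of equal rank fit together to a homeomorphism of the
  plane.\<close>

section \<open>Resultants under specialisation\<close>

text \<open>Continuity of roots says only that a multiple root over a critical value becomes a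
  cluster of nearby roots; it does not say whether the roots of the cluster remain equal.
  \<open>R\<close> controls \<open>F\<close> over the critical value only indirectly, because simple
  roots in \<open>y\<close> are known just where \<open>M\<close> does not vanish. This forces the
  detour through complex \<open>x\<close>: a small circle around \<open>b\<close> avoids the zeros
  of \<open>M\<close> for all nearby parameters at once, and compactness makes the separation over
  it uniform. Simplicity of the roots of \<open>M\<close> is used twice: it lets the critical values
  move continuously, and it leaves exactly one of them in the disc, so that the disc has a single
  puncture. The leading coefficient in \<open>y\<close> cannot vanish where the discriminant does
  not. Being free of \<open>x\<close>, it is then nonzero over every \<open>x\<close>, critical ones
  included; so the degree of the fibre polynomial is constant and no root escapes to infinity. All
  this is local in \<open>(t,s)\<close>; connectedness carries it to the whole component.\<close>

lemma sylvester_specialisation_singular: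
  fixes F G :: "'a::idom poly" and h :: "'a \<Rightarrow> 'b::field" and v :: "nat \<Rightarrow> 'b"
  assumes h: "comm_ring_hom h"
    and rows: "\<And>i. i < degree F + degree G \<Longrightarrow>
      (\<Sum>j<degree F + degree G. h (sylvester_mat F G $$ (i, j)) * v j) = 0"
    and j0: "j0 < degree F + degree G" "v j0 \<noteq> 0"
  shows "h (resultant F G) = 0"
proof -
  interpret comm_ring_hom h by fact
  define N where "N = degree F + degree G"
  \<comment> \<open>The Sylvester matrix keeps its formal size under \<open>h\<close>, even if the
    degrees of the images drop; so its determinant is always the image of the resultant, and a
    kernel vector is enough.\<close>
  define A where "A = map_mat h (sylvester_mat F G)"
  have A: "A \<in> carrier_mat N N" unfolding A_def N_def by auto
  define w where "w = Matrix.vec N v"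
  have w: "w \<in> carrier_vec N" "w \<noteq> 0\<^sub>v N"
    using j0 unfolding w_def N_def by (auto simp: vec_eq_iff)
  have "A *\<^sub>v w = 0\<^sub>v N"
  proof
    show "dim_vec (A *\<^sub>v w) = dim_vec (0\<^sub>v N)" using A by simp
    fix i assume "i < dim_vec (0\<^sub>v N :: 'b Matrix.vec)"
    then have i: "i < N" by simp
    have "(\<Sum>j<N. h (sylvester_mat F G $$ (i, j)) * v j) = 0"
      using rows[of i] i unfolding N_def by simp
    then show "vec_index (A *\<^sub>v w) i = vec_index (0\<^sub>v N) i"
      using i A unfolding w_def A_def N_def
      by (simp add: scalar_prod_def lessThan_atLeast0)
  qed
  then have "Determinant.det A = 0"
    using det_0_iff_vec_prod_zero[OF A] w by auto
  then show ?thesis unfolding A_def resultant_def by (simp add: hom_det)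
qed

text \<open>The first column of the Sylvester matrix of \<open>F\<close> and its derivative contains
  only zeros and the two leading coefficients, both multiples of that of \<open>F\<close>. If
  \<open>h\<close> kills it, the first unit vector lies in the kernel.\<close>

lemma hom_lead_coeff_nonzero:
  fixes F :: "'a::{idom, ring_char_0} poly" and h :: "'a \<Rightarrow> 'b::field"
  assumes h: "comm_ring_hom h" and n: "degree F > 0" and ne: "h (Dres F) \<noteq> 0"
  shows "h (lead_coeff F) \<noteq> 0"
proof
  interpret comm_ring_hom h by fact
  assume l: "h (lead_coeff F) = 0"
  let ?G = "pderiv F"
  have "lead_coeff ?G = of_nat (degree F) * lead_coeff F"
    using n by (simp add: coeff_pderiv degree_pderiv)
  then have G: "h (lead_coeff ?G) = 0" using l by (simp only: hom_mult mult_zero_right)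
  have "h (resultant F ?G) = 0"
  proof (rule sylvester_specialisation_singular[OF h, where v = "\<lambda>j. if j = 0 then 1 else 0" and ?j0.0 = 0])
    fix i assume i: "i < degree F + degree ?G"
    have "h (sylvester_mat F ?G $$ (i, 0)) = 0"
      using i n l G by (subst sylvester_index_mat) auto
    then show "(\<Sum>j<degree F + degree ?G. h (sylvester_mat F ?G $$ (i, j)) * (if j = 0 then 1 else 0)) = 0"
      by (intro sum.neutral) auto
  qed (use n in auto)
  with ne show False by (simp add: Dres_def)
qed

text \<open>The rows of the Sylvester matrix are shifted coefficient lists of \<open>F\<close> and
  its derivative, so multiplying by the vector of powers of \<open>z\<close> evaluates at
  \<open>z\<close>. A common root puts this vector into the kernel, and its last entry
  \<open>z ^ 0\<close> is never zero. The degrees of the images play no part in this.\<close>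

lemma hom_Dres_simple_roots:
  fixes F :: "'a::{idom, ring_char_0} poly" and h :: "'a \<Rightarrow> 'b::field"
  assumes h: "comm_ring_hom h" and n: "degree F > 0" and ne: "h (Dres F) \<noteq> 0"
    and r: "poly (map_poly h F) z = 0"
  shows "poly (pderiv (map_poly h F)) z \<noteq> 0"
proof
  interpret comm_ring_hom h by fact
  assume r': "poly (pderiv (map_poly h F)) z = 0"
  define G where "G = pderiv F"
  have G: "map_poly h G = pderiv (map_poly h F)"
    unfolding G_def by (rule poly_eqI) (simp add: coeff_pderiv hom_distribs)
  define N where "N = degree F + degree G"
  \<comment> \<open>The matrix entries are coefficients at \<open>N - j\<close> of a product with
    \<open>monom 1 (Suc k)\<close>, one degree higher than the power of \<open>z\<close> they meet.
    Cancelling one factor of the variable gives the polynomial \<open>?Q\<close> below.\<close>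
  have key: "(\<Sum>j<N. h (coeff (monom 1 (Suc k) * H) (N - j)) * z ^ (N - 1 - j)) = 0"
    if H: "poly (map_poly h H) z = 0" and k: "k + degree H < N" for k and H :: "'a poly"
  proof -
    let ?Q = "monom 1 k * map_poly h H"
    have dQ: "degree ?Q < N"
      using k degree_map_poly_le[of h H] degree_mult_le[of "monom 1 k" "map_poly h H"]
        degree_monom_le[of "1::'b" k] by linarith
    have "(\<Sum>j<N. h (coeff (monom 1 (Suc k) * H) (N - j)) * z ^ (N - 1 - j)) =
      (\<Sum>j<N. coeff ?Q (N - 1 - j) * z ^ (N - 1 - j))"
      by (intro sum.cong refl) (auto simp: coeff_monom_mult)
    also have "\<dots> = (\<Sum>j<N. coeff ?Q j * z ^ j)"
      using sum.nat_diff_reindex[of "\<lambda>j. coeff ?Q j * z ^ j" N] by simp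
    also have "\<dots> = poly ?Q z" using dQ
      by (subst poly_altdef) (intro sum.mono_neutral_right, auto simp: coeff_eq_0)
    also have "\<dots> = 0" using H by simp
    finally show ?thesis .
  qed
  have "h (resultant F G) = 0"
  proof (rule sylvester_specialisation_singular[OF h, where v = "\<lambda>j. z ^ (N - 1 - j)" and ?j0.0 = "N - 1"])
    fix i assume i: "i < degree F + degree G"
    show "(\<Sum>j<degree F + degree G. h (sylvester_mat F G $$ (i, j)) * z ^ (N - 1 - j)) = 0"
    proof (cases "i < degree G")
      case True
      have "Suc (degree G - i - 1) = degree G - i" using True by simp
      then show ?thesis using key[OF r, of "degree G - i - 1"] True i
        unfolding N_def by (simp add: sylvester_index_mat2)
    next
      case False
      have "Suc (degree F + degree G - i - 1) = degree F + degree G - i" using i by simp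
      then show ?thesis using key[of G "degree F + degree G - i - 1"] False i r' G
        unfolding N_def by (simp add: sylvester_index_mat2)
    qed
  qed (use n in \<open>auto simp: N_def\<close>)
  with ne show False by (simp add: Dres_def G_def)
qed

lemma prod_mset_dvd_power_size:
  fixes m :: "'a::comm_semiring_1"
  assumes "\<And>p. p \<in># S \<Longrightarrow> p dvd m"
  shows "prod_mset S dvd m ^ size S"
  using assms by (induction S) (auto intro: mult_dvd_mono)

text \<open>The conventions for degree zero yield the positive degrees. Divisibility holds because
  every prime factor of the discriminant divides its square-free part; it is used to conclude that
  \<open>Dres F\<close> is nonzero at each point where \<open>M_of F\<close> is.\<close>

lemma R_of_nonzero:
  fixes F :: "real poly poly poly poly"
  assumes R: "R_of F \<noteq> 0"
  shows "degree F > 0" "degree (M_of F) > 0" "Dres F \<noteq> 0" "\<exists>k. Dres F dvd M_of F ^ k"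
proof -
  show 1: "degree (M_of F) > 0" using R by (auto simp: R_of_def Let_def split: if_splits)
  then show 2: "degree F > 0" by (auto simp: M_of_def split: if_splits)
  have M: "M_of F = sqfree_part (Dres F)" using 2 by (simp add: M_of_def)
  with 1 show 3: "Dres F \<noteq> 0" by (auto simp: sqfree_part_def)
  let ?P = "prime_factorization (Dres F)"
  have "Dres F dvd prod_mset ?P"
    using prod_mset_prime_factorization_weak[OF 3] by (metis associatedD1 normalize_dvd_iff dvd_refl)
  also have "\<dots> dvd M_of F ^ size ?P"
    by (rule prod_mset_dvd_power_size) (use 3 in \<open>auto simp: M sqfree_part_def intro: dvd_prodI\<close>)
  finally show "\<exists>k. Dres F dvd M_of F ^ k" by blast
qed

section \<open>Continuity of roots\<close>

abbreviation roots :: "complex poly \<Rightarrow> complex set" where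
  "roots p \<equiv> {z. poly p z = 0}"

lemma card_roots_rsquarefree:
  fixes p :: "complex poly"
  assumes "rsquarefree p"
  shows "card (roots p) = degree p"
proof -
  have p: "p \<noteq> 0" using assms by (auto simp: rsquarefree_def)
  have "degree p = degree (Polynomial.smult (lead_coeff p) (\<Prod>z|poly p z = 0. [:-z, 1:]))"
    using complex_poly_decompose_rsquarefree[OF assms] by simp
  also have "\<dots> = card (roots p)"
    using p by (simp add: degree_prod_eq_sum_degree)
  finally show ?thesis by simp
qed

text \<open>Over the complex numbers the value at \<open>z\<close> is the leading coefficient times
  the product of the differences to the roots. Read contrapositively, a small value forces a nearby
  root; both continuity results below rest on this.\<close>

lemma poly_norm_ge_of_root_dist:
  fixes p :: "complex poly"
  assumes B: "0 \<le> B" and far: "\<And>w. poly p w = 0 \<Longrightarrow> B \<le> dist w z"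
  shows "norm (lead_coeff p) * B ^ degree p \<le> norm (poly p z)"
proof (cases "p = 0")
  case False
  obtain r where r: "Polynomial.smult (lead_coeff p) (\<Prod>i<degree p. [:- r i, 1:]) = p"
    using complex_poly_decompose' by blast
  have ev: "poly p x = lead_coeff p * (\<Prod>i<degree p. x - r i)" for x
    by (subst r[symmetric]) (simp add: poly_prod)
  have root: "poly p (r i) = 0" if "i < degree p" for i
    using that by (subst ev) auto
  have "B ^ degree p = (\<Prod>i<degree p. B)" by simp
  also have "\<dots> \<le> (\<Prod>i<degree p. norm (z - r i))"
    using B far[OF root] by (intro prod_mono) (auto simp: dist_norm norm_minus_commute)
  finally show ?thesis
    unfolding ev[of z] by (simp add: norm_mult prod_norm[symmetric] mult_left_mono)
qed auto

text \<open>An arbitrary filter lets the same results serve moving parameters, moving points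
  \<open>x\<close> and pairs of both. The eventual equality of degrees keeps roots from escaping to
  infinity.\<close>

definition poly_tends :: "('b \<Rightarrow> complex poly) \<Rightarrow> complex poly \<Rightarrow> 'b filter \<Rightarrow> bool" where
  "poly_tends f p U \<longleftrightarrow> p \<noteq> 0 \<and> (\<forall>\<^sub>F u in U. degree (f u) = degree p) \<and>
     (\<forall>i. ((\<lambda>u. coeff (f u) i) \<longlongrightarrow> coeff p i) U)"

lemma poly_tends_poly:
  assumes "poly_tends f p U"
  shows "((\<lambda>u. poly (f u) z) \<longlongrightarrow> poly p z) U"
proof -
  have "((\<lambda>u. \<Sum>i\<le>degree p. coeff (f u) i * z ^ i) \<longlongrightarrow> (\<Sum>i\<le>degree p. coeff p i * z ^ i)) U"
    using assms by (intro tendsto_intros) (auto simp: poly_tends_def)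
  then have "((\<lambda>u. \<Sum>i\<le>degree p. coeff (f u) i * z ^ i) \<longlongrightarrow> poly p z) U"
    by (simp add: poly_altdef)
  moreover have "\<forall>\<^sub>F u in U. (\<Sum>i\<le>degree p. coeff (f u) i * z ^ i) = poly (f u) z"
    using assms unfolding poly_tends_def by (auto elim!: eventually_mono simp: poly_altdef)
  ultimately show ?thesis by (rule Lim_transform_eventually)
qed

text \<open>The values at \<open>z\<close> tend to 0, whereas the lower bound valid in the absence
  of roots within \<open>e\<close> tends to a positive number.\<close>

lemma poly_tends_root_near:
  assumes t: "poly_tends f p U" and z: "poly p z = 0" and e: "0 < e"
  shows "\<forall>\<^sub>F u in U. \<exists>w. poly (f u) w = 0 \<and> dist w z < e"
proof -
  let ?c = "norm (lead_coeff p)" and ?n = "degree p"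
  have c: "0 < ?c" using t by (simp add: poly_tends_def)
  have "((\<lambda>u. norm (coeff (f u) ?n) * e ^ ?n - norm (poly (f u) z)) \<longlongrightarrow> ?c * e ^ ?n - norm (poly p z)) U"
    using t by (intro tendsto_intros poly_tends_poly) (auto simp: poly_tends_def)
  moreover have "0 < ?c * e ^ ?n - norm (poly p z)" using c e z by simp
  ultimately have "\<forall>\<^sub>F u in U. 0 < norm (coeff (f u) ?n) * e ^ ?n - norm (poly (f u) z)"
    by (rule order_tendstoD)
  moreover have "\<forall>\<^sub>F u in U. degree (f u) = ?n" using t by (simp add: poly_tends_def)
  ultimately show ?thesis
  proof eventually_elim
    case (elim u)
    show ?case
    proof (rule ccontr)
      assume "\<not> ?thesis"
      then have "norm (lead_coeff (f u)) * e ^ degree (f u) \<le> norm (poly (f u) z)"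
        using e by (intro poly_norm_ge_of_root_dist) (auto simp: not_less)
      with elim show False by simp
    qed
  qed
qed

text \<open>A point \<open>w\<close> at distance at least \<open>e\<close> from all roots of \<open>p\<close> is at distance at least
  \<open>k (1 + \<bar>w\<bar>)\<close> from them, with \<open>k\<close> depending on \<open>e\<close> and \<open>p\<close> only; this spares an a priori bound
  on the roots of \<open>f u\<close>.\<close>

lemma poly_tends_roots_within:
  assumes t: "poly_tends f p U" and e: "0 < e"
  shows "\<forall>\<^sub>F u in U. \<forall>w. poly (f u) w = 0 \<longrightarrow> (\<exists>z. poly p z = 0 \<and> dist w z < e)"
proof -
  let ?c = "norm (lead_coeff p)" and ?n = "degree p"
  have p: "p \<noteq> 0" and c: "0 < ?c" using t by (auto simp: poly_tends_def)
  have fin: "finite (roots p)" using p by (rule poly_roots_finite)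
  obtain K where K: "0 \<le> K" "\<And>z. poly p z = 0 \<Longrightarrow> norm z \<le> K"
    using finite_imp_bounded[OF fin] unfolding bounded_pos by (auto intro: less_imp_le)
  \<comment> \<open>For \<open>dist z w\<close> at least \<open>e\<close>, the number
    \<open>1 + K\<close> is at most \<open>(1 + K) / e\<close> times that distance; adding the
    distance itself bounds \<open>1 + norm w\<close>.\<close>
  define k where "k = 1 / ((1 + K) / e + 1)"
  have k: "0 < k" unfolding k_def using K e by (auto intro!: divide_pos_pos add_nonneg_pos)
  have far: "k * (1 + norm w) \<le> dist z w" if "poly p z = 0" "e \<le> dist w z" for w z
  proof -
    have "1 + norm w \<le> 1 + K + dist z w"
      using K(2)[OF that(1)] norm_triangle_ineq[of z "w - z"] by (simp add: dist_norm norm_minus_commute)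
    also have "1 + K \<le> ((1 + K) / e) * dist z w"
    proof -
      have "(1 + K) / e * e \<le> ((1 + K) / e) * dist z w"
        using that(2) e K(1) by (intro mult_left_mono) (auto simp: dist_commute)
      then show ?thesis using e by simp
    qed
    finally have "1 + norm w \<le> ((1 + K) / e + 1) * dist z w" by (simp add: algebra_simps)
    then show ?thesis unfolding k_def using K e
      by (simp add: divide_simps add_nonneg_pos split: if_splits) (auto simp: algebra_simps add_pos_nonneg)
  qed
  have "((\<lambda>u. ?c * k ^ ?n - (\<Sum>i\<le>?n. norm (coeff p i - coeff (f u) i))) \<longlongrightarrow>
     ?c * k ^ ?n - (\<Sum>i\<le>?n. norm (coeff p i - coeff p i))) U"
    using t by (intro tendsto_intros) (auto simp: poly_tends_def)
  moreover have "0 < ?c * k ^ ?n - (\<Sum>i\<le>?n. norm (coeff p i - coeff p i))" using c k by simp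
  ultimately have "\<forall>\<^sub>F u in U. 0 < ?c * k ^ ?n - (\<Sum>i\<le>?n. norm (coeff p i - coeff (f u) i))"
    by (rule order_tendstoD)
  moreover have "\<forall>\<^sub>F u in U. degree (f u) = ?n" using t by (simp add: poly_tends_def)
  ultimately show ?thesis
  proof eventually_elim
    case (elim u)
    show ?case
    proof (intro allI impI, rule ccontr)
      fix w assume w: "poly (f u) w = 0" and "\<not> (\<exists>z. poly p z = 0 \<and> dist w z < e)"
      then have "k * (1 + norm w) \<le> dist z w" if "poly p z = 0" for z
        using far[OF that] that by (auto simp: not_less)
      \<comment> \<open>Lower and upper bound both carry the factor
        \<open>(1 + norm w) ^ ?n\<close>. After cancelling it, only coefficient differences remain,
        and these tend to 0.\<close>
      then have "?c * (k * (1 + norm w)) ^ ?n \<le> norm (poly p w)"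
        using k by (intro poly_norm_ge_of_root_dist) auto
      also have "poly p w = poly p w - poly (f u) w" using w by simp
      also have "\<dots> = (\<Sum>i\<le>?n. (coeff p i - coeff (f u) i) * w ^ i)"
        using elim by (simp add: poly_altdef algebra_simps sum_subtractf)
      also have "norm \<dots> \<le> (\<Sum>i\<le>?n. norm (coeff p i - coeff (f u) i) * (1 + norm w) ^ ?n)"
      proof (intro sum_norm_le)
        fix i assume "i \<in> {..?n}"
        then have "norm w ^ i \<le> (1 + norm w) ^ i" "(1 + norm w) ^ i \<le> (1 + norm w) ^ ?n"
          by (auto intro!: power_mono power_increasing)
        then show "norm ((coeff p i - coeff (f u) i) * w ^ i) \<le> norm (coeff p i - coeff (f u) i) * (1 + norm w) ^ ?n"
          by (simp add: norm_mult norm_power mult_left_mono)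
      qed
      also have "\<dots> = (\<Sum>i\<le>?n. norm (coeff p i - coeff (f u) i)) * (1 + norm w) ^ ?n"
        by (simp add: sum_distrib_right)
      finally have "(?c * k ^ ?n) * (1 + norm w) ^ ?n \<le>
          (\<Sum>i\<le>?n. norm (coeff p i - coeff (f u) i)) * (1 + norm w) ^ ?n"
        by (simp add: power_mult_distrib mult_ac)
      moreover have "0 < (1 + norm w) ^ ?n" by (intro zero_less_power add_pos_nonneg) auto
      ultimately have "?c * k ^ ?n \<le> (\<Sum>i\<le>?n. norm (coeff p i - coeff (f u) i))"
        by (simp only: mult_le_cancel_right_pos)
      then show False using elim by simp
    qed
  qed
qed

section \<open>Pairing the points of nearby finite sets\<close>

text \<open>Sets of roots carry no multiplicities, so for a critical fibre \<open>Z\<close> the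
  uniqueness of \<open>w\<close> says exactly that no multiple root splits.\<close>

definition matched :: "real \<Rightarrow> 'a::metric_space set \<Rightarrow> 'a set \<Rightarrow> bool" where
  "matched e Z W \<longleftrightarrow> (\<forall>w\<in>W. \<exists>z\<in>Z. dist w z < e) \<and> (\<forall>z\<in>Z. \<exists>!w. w \<in> W \<and> dist w z < e)"

definition separated :: "real \<Rightarrow> 'a::metric_space set \<Rightarrow> bool" where
  "separated e Z \<longleftrightarrow> (\<forall>z\<in>Z. \<forall>w\<in>Z. z \<noteq> w \<longrightarrow> e \<le> dist z w)"

text \<open>Separation of \<open>Z\<close> makes the choice of a nearby point injective, and equal
  cardinality makes it onto. This is the version for simple roots, whose number is known to be the
  degree.\<close>

lemma matched_of_card:
  fixes Z W :: "'a::metric_space set"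
  assumes fin: "finite Z" "finite W" and card: "card W = card Z"
    and ex: "\<And>z. z \<in> Z \<Longrightarrow> \<exists>w\<in>W. dist w z < e" and sep: "separated (2 * e) Z"
  shows "matched e Z W"
proof -
  obtain g where g: "\<And>z. z \<in> Z \<Longrightarrow> g z \<in> W \<and> dist (g z) z < e" using ex by metis
  have close: "z = z'" if "z \<in> Z" "z' \<in> Z" "dist w z < e" "dist w z' < e" for w z z'
    using sep that dist_triangle[of z z' w] unfolding separated_def by (fastforce simp: dist_commute)
  have inj: "inj_on g Z" using g close by (intro inj_onI) metis
  have "g ` Z = W" using g inj fin card by (intro card_subset_eq) (auto simp: card_image)
  then show ?thesis unfolding matched_def using g close by (metis imageE)
qed

text \<open>Here separation of \<open>W\<close> replaces the count: two of its points near the same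
  \<open>z\<close> would be too close. This version is for critical fibres, where the number of
  distinct roots is not known beforehand.\<close>

lemma matched_of_separated:
  fixes Z W :: "'a::metric_space set"
  assumes "\<And>z. z \<in> Z \<Longrightarrow> \<exists>w\<in>W. dist w z < e" "\<And>w. w \<in> W \<Longrightarrow> \<exists>z\<in>Z. dist w z < e"
    and sep: "separated (2 * e) W"
  shows "matched e Z W"
proof -
  have "w = w'" if "w \<in> W" "w' \<in> W" "dist w z < e" "dist w' z < e" for w w' z
    using sep that dist_triangle2[of w w' z] unfolding separated_def by fastforce
  then show ?thesis unfolding matched_def using assms by metis
qed

abbreviation nth_elem :: "real set \<Rightarrow> nat \<Rightarrow> real" where
  "nth_elem S k \<equiv> sorted_list_of_set S ! k"

text \<open>Points at least \<open>2 * e\<close> apart that move by less than \<open>e\<close>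
  cannot change their order, so the pairing carries one sorted list to the other.\<close>

lemma nth_elem_matched:
  fixes S T :: "real set"
  assumes fin: "finite S" and m: "matched e S T" and sep: "separated (2 * e) S"
  shows "card T = card S" "\<And>k. k < card S \<Longrightarrow> \<bar>nth_elem T k - nth_elem S k\<bar> < e"
proof -
  obtain g where g: "\<And>s. s \<in> S \<Longrightarrow> g s \<in> T \<and> dist (g s) s < e"
    using m unfolding matched_def by metis
  have T: "T = g ` S"
  proof
    show "g ` S \<subseteq> T" using g by auto
    show "T \<subseteq> g ` S"
    proof
      fix t assume t: "t \<in> T"
      then obtain s where s: "s \<in> S" "dist t s < e" using m unfolding matched_def by metis
      then have "t = g s" using m g[OF s(1)] t unfolding matched_def by metis
      then show "t \<in> g ` S" using s by simp
    qed
  qed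
  have mono: "g s < g s'" if "s \<in> S" "s' \<in> S" "s < s'" for s s'
  proof -
    have "2 * e \<le> dist s s'" using sep that unfolding separated_def by auto
    then show ?thesis using g[OF that(1)] g[OF that(2)] that(3) by (auto simp: dist_real_def)
  qed
  have inj: "inj_on g S" using mono by (intro inj_onI) (metis less_irrefl linorder_cases)
  show card: "card T = card S" unfolding T by (rule card_image[OF inj])
  have "sorted_wrt (<) (map g (sorted_list_of_set S))"
    unfolding sorted_wrt_map
    by (rule sorted_wrt_mono_rel[OF _ strict_sorted_list_of_set[of S]]) (use mono fin in auto)
  then have l: "sorted_list_of_set T = map g (sorted_list_of_set S)"
    using fin unfolding T by (intro sorted_list_of_set_unique[THEN iffD1]) (auto simp: strict_sorted_iff card_image[OF inj])
  show "\<bar>nth_elem T k - nth_elem S k\<bar> < e" if "k < card S" for k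
  proof -
    have "nth_elem S k \<in> S" using that fin by (metis length_sorted_list_of_set nth_mem set_sorted_list_of_set)
    then show ?thesis using g that unfolding l by (simp add: dist_real_def)
  qed
qed

abbreviation real_part :: "complex set \<Rightarrow> real set" where
  "real_part Z \<equiv> {x. complex_of_real x \<in> Z}"

text \<open>Conjugation preserves the distance to a real point, so the unique partner of a real
  point equals its conjugate and is real. Conversely, no real point is close to a nonreal
  \<open>z\<close>, which lies at distance at least \<open>e\<close> from the axis.\<close>

lemma matched_real_part:
  fixes Z W :: "complex set"
  assumes m: "matched e Z W"
    and cnj: "\<And>w. w \<in> W \<Longrightarrow> cnj w \<in> W"
    and nonreal: "\<And>z. z \<in> Z \<Longrightarrow> Im z \<noteq> 0 \<Longrightarrow> e \<le> \<bar>Im z\<bar>"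
  shows "matched e (real_part Z) (real_part W)"
  unfolding matched_def
proof (intro conjI ballI)
  fix x assume "x \<in> real_part W"
  then have x: "complex_of_real x \<in> W" by simp
  then obtain z where z: "z \<in> Z" "dist (complex_of_real x) z < e" using m unfolding matched_def by metis
  have "\<bar>Im z\<bar> < e" using z(2) abs_Im_le_cmod[of "complex_of_real x - z"] by (simp add: dist_norm)
  then have "Im z = 0" using nonreal[OF z(1)] by linarith
  then obtain y where y: "z = complex_of_real y" using complex_is_Real_iff[of z] by (auto elim: Reals_cases)
  have "dist x y < e" using z(2) unfolding y by (simp only: dist_of_real)
  moreover have "y \<in> real_part Z" using z(1) unfolding y by (simp only: mem_Collect_eq)
  ultimately show "\<exists>s\<in>real_part Z. dist x s < e" by blast
next
  fix x assume "x \<in> real_part Z"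
  then have x: "complex_of_real x \<in> Z" by simp
  then obtain w where w: "w \<in> W" "dist w (complex_of_real x) < e"
    and u: "\<And>w'. w' \<in> W \<Longrightarrow> dist w' (complex_of_real x) < e \<Longrightarrow> w' = w"
    using m unfolding matched_def by metis
  have "dist (cnj w) (complex_of_real x) = dist w (complex_of_real x)"
    by (metis complex_cnj_complex_of_real complex_cnj_diff complex_mod_cnj dist_norm)
  then have "cnj w = w" using u[OF cnj[OF w(1)]] w(2) by simp
  then have wr: "w = complex_of_real (Re w)" by (simp add: complex_eq_iff)
  show "\<exists>!t. t \<in> real_part W \<and> dist t x < e"
  proof (rule ex1I[of _ "Re w"])
    show "Re w \<in> real_part W \<and> dist (Re w) x < e"
      using w wr by (metis dist_of_real mem_Collect_eq)
    fix t assume "t \<in> real_part W \<and> dist t x < e"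
    then have "complex_of_real t = w" using u[of "complex_of_real t"] by simp
    then show "t = Re w" by auto
  qed
qed

lemma separated_real_part: "separated e Z \<Longrightarrow> separated e (real_part Z)"
  unfolding separated_def by (auto simp: dist_of_real[symmetric, where 'a = complex] simp del: dist_of_real)

lemma finite_real_part: "finite Z \<Longrightarrow> finite (real_part Z)"
  using finite_vimageI[of Z complex_of_real] by (simp add: vimage_def inj_def)

lemma ex_separated:
  fixes Z :: "complex set"
  assumes "finite Z"
  obtains e where "0 < e" "separated e Z" "\<And>z. z \<in> Z \<Longrightarrow> Im z \<noteq> 0 \<Longrightarrow> e \<le> \<bar>Im z\<bar>"
proof -
  \<comment> \<open>The 1 keeps the set nonempty if \<open>Z\<close> has no two points and no
    nonreal one; removing 0 discards coincident pairs and real points.\<close>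
  let ?A = "insert 1 ((\<lambda>(z, w). dist z w) ` (Z \<times> Z) \<union> (\<lambda>z. \<bar>Im z\<bar>) ` Z) - {0::real}"
  have fin: "finite ?A" using assms by auto
  have ne: "?A \<noteq> {}" by auto
  have pos: "0 < Min ?A" using fin ne Min_in[OF fin ne] by auto
  show ?thesis
  proof (rule that[OF pos])
    show "separated (Min ?A) Z" unfolding separated_def
      by (intro ballI impI Min_le[OF fin]) force
    show "Min ?A \<le> \<bar>Im z\<bar>" if "z \<in> Z" "Im z \<noteq> 0" for z
      using that by (intro Min_le[OF fin]) force
  qed
qed

lemma separated_mono: "separated e Z \<Longrightarrow> d \<le> e \<Longrightarrow> separated d Z"
  unfolding separated_def by fastforce

lemma poly_tends_matched:
  assumes t: "poly_tends f p U" and p: "rsquarefree p" and f: "\<forall>\<^sub>F u in U. rsquarefree (f u)"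
    and e: "0 < e" "separated (2 * e) (roots p)"
  shows "\<forall>\<^sub>F u in U. matched e (roots p) (roots (f u))"
proof -
  have p0: "p \<noteq> 0" using t by (simp add: poly_tends_def)
  have fin: "finite (roots p)" using p0 by (rule poly_roots_finite)
  have "\<forall>\<^sub>F u in U. \<forall>z\<in>roots p. \<exists>w. poly (f u) w = 0 \<and> dist w z < e"
    using fin poly_tends_root_near[OF t _ e(1)] by (intro eventually_ball_finite) auto
  moreover have "\<forall>\<^sub>F u in U. degree (f u) = degree p" using t by (simp add: poly_tends_def)
  ultimately show ?thesis using f
  proof eventually_elim
    case (elim u)
    then have "f u \<noteq> 0" by (auto simp: rsquarefree_def)
    then have "finite (roots (f u))" by (rule poly_roots_finite)
    then show ?case using fin elim p e(2)
      by (intro matched_of_card) (auto simp: card_roots_rsquarefree)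
  qed
qed

definition real_coeffs :: "complex poly \<Rightarrow> bool" where
  "real_coeffs p \<longleftrightarrow> (\<forall>i. coeff p i \<in> \<real>)"

lemma cnj_roots: "real_coeffs p \<Longrightarrow> z \<in> roots p \<Longrightarrow> cnj z \<in> roots p"
  unfolding real_coeffs_def using poly_cnj_real[of p z] by simp

abbreviation real_roots :: "complex poly \<Rightarrow> real set" where
  "real_roots p \<equiv> real_part (roots p)"

text \<open>Simple real roots cannot leave the axis, as they would have to do so in conjugate pairs,
  and nonreal roots stay away from it. So the real roots move without changing their number or
  order.\<close>

lemma poly_tends_nth_real_root:
  assumes t: "poly_tends f p U" and p: "rsquarefree p"
    and f: "\<forall>\<^sub>F u in U. rsquarefree (f u) \<and> real_coeffs (f u)"
  shows "\<forall>\<^sub>F u in U. card (real_roots (f u)) = card (real_roots p)"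
    "k < card (real_roots p) \<Longrightarrow>
       ((\<lambda>u. nth_elem (real_roots (f u)) k) \<longlongrightarrow> nth_elem (real_roots p) k) U"
proof -
  have p0: "p \<noteq> 0" using t by (simp add: poly_tends_def)
  have fin: "finite (roots p)" using p0 by (rule poly_roots_finite)
  obtain e0 where e0: "0 < e0" "separated e0 (roots p)"
    "\<And>z. z \<in> roots p \<Longrightarrow> Im z \<noteq> 0 \<Longrightarrow> e0 \<le> \<bar>Im z\<bar>" using ex_separated[OF fin] by blast
  have main: "\<forall>\<^sub>F u in U. card (real_roots (f u)) = card (real_roots p) \<and>
     (\<forall>k < card (real_roots p). \<bar>nth_elem (real_roots (f u)) k - nth_elem (real_roots p) k\<bar> < e)"
    if e: "0 < e" "e \<le> e0 / 2" for e
  proof -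
    have sep: "separated (2 * e) (roots p)" using separated_mono[OF e0(2)] e by simp
    have "\<forall>\<^sub>F u in U. matched e (roots p) (roots (f u))"
      using f by (intro poly_tends_matched[OF t p _ e(1) sep]) (auto elim: eventually_mono)
    then show ?thesis using f
    proof eventually_elim
      case (elim u)
      have nr: "e \<le> \<bar>Im z\<bar>" if "z \<in> roots p" "Im z \<noteq> 0" for z
        using e0(3)[OF that] e e0(1) by linarith
      have "matched e (real_roots p) (real_roots (f u))"
        using elim by (intro matched_real_part cnj_roots nr) auto
      from nth_elem_matched[OF finite_real_part[OF fin] this separated_real_part[OF sep]]
      show ?case by auto
    qed
  qed
  show "\<forall>\<^sub>F u in U. card (real_roots (f u)) = card (real_roots p)"
    using main[of "e0 / 2"] e0(1) by (auto elim: eventually_mono)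
  show "((\<lambda>u. nth_elem (real_roots (f u)) k) \<longlongrightarrow> nth_elem (real_roots p) k) U"
    if k: "k < card (real_roots p)"
  proof (rule tendstoI)
    fix e :: real assume "0 < e"
    then have "\<forall>\<^sub>F u in U. \<forall>k < card (real_roots p).
        \<bar>nth_elem (real_roots (f u)) k - nth_elem (real_roots p) k\<bar> < min e (e0 / 2)"
      using eventually_mono[OF main[of "min e (e0 / 2)"]] e0(1) by (simp only: min_less_iff_conj) simp
    then show "\<forall>\<^sub>F u in U. dist (nth_elem (real_roots (f u)) k) (nth_elem (real_roots p) k) < e"
      by eventually_elim (use k in \<open>auto simp: dist_real_def\<close>)
  qed
qed

section \<open>Continuous families of polynomials of constant degree\<close>

definition poly_family :: "'b::topological_space set \<Rightarrow> ('b \<Rightarrow> complex poly) \<Rightarrow> bool" where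
  "poly_family S f \<longleftrightarrow> (\<forall>i. continuous_on S (\<lambda>x. coeff (f x) i)) \<and>
     (\<forall>x\<in>S. \<forall>y\<in>S. degree (f x) = degree (f y)) \<and> (\<forall>x\<in>S. f x \<noteq> 0)"

abbreviation nhds_in :: "'b::topological_space \<Rightarrow> 'b set \<Rightarrow> 'b filter" where
  "nhds_in x S \<equiv> inf (nhds x) (principal S)"

lemma eventually_nhds_in:
  "eventually Q (nhds_in x S) \<longleftrightarrow> (\<exists>T. open T \<and> x \<in> T \<and> (\<forall>y\<in>T \<inter> S. Q y))"
  unfolding eventually_inf_principal eventually_nhds by auto

lemma continuous_on_nhds_in:
  assumes "continuous_on S f" "x \<in> S"
  shows "(f \<longlongrightarrow> f x) (nhds_in x S)"
proof (rule topological_tendstoI)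
  fix V assume V: "open V" "f x \<in> V"
  then obtain T where "open T" "T \<inter> S = f -` V \<inter> S"
    using assms(1) continuous_on_open_invariant by metis
  then show "\<forall>\<^sub>F y in nhds_in x S. f y \<in> V"
    unfolding eventually_nhds_in using V assms(2) by (intro exI[of _ T]) auto
qed

lemma poly_family_tends:
  assumes "poly_family S f" "x \<in> S"
  shows "poly_tends f (f x) (nhds_in x S)"
  unfolding poly_tends_def
proof (intro conjI allI)
  show "f x \<noteq> 0" using assms by (auto simp: poly_family_def)
  show "\<forall>\<^sub>F u in nhds_in x S. degree (f u) = degree (f x)"
  proof -
    have "\<forall>u\<in>S. degree (f u) = degree (f x)" using assms unfolding poly_family_def by blast
    then show ?thesis unfolding eventually_inf_principal by (intro always_eventually) blast
  qed
  show "((\<lambda>u. coeff (f u) i) \<longlongrightarrow> coeff (f x) i) (nhds_in x S)" for i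
    using assms unfolding poly_family_def by (intro continuous_on_nhds_in) auto
qed

lemma poly_family_subset: "poly_family S f \<Longrightarrow> T \<subseteq> S \<Longrightarrow> poly_family T f"
  unfolding poly_family_def by (meson continuous_on_subset subsetD)

lemma poly_family_compose:
  assumes "poly_family S f" "continuous_on T g" "g ` T \<subseteq> S"
  shows "poly_family T (\<lambda>x. f (g x))"
  unfolding poly_family_def
proof (intro conjI allI ballI)
  show "continuous_on T (\<lambda>x. coeff (f (g x)) i)" for i
    using assms by (intro continuous_on_compose2[of S "\<lambda>x. coeff (f x) i" T g]) (simp_all add: poly_family_def)
  show "degree (f (g x)) = degree (f (g y))" if "x \<in> T" "y \<in> T" for x y
    using assms that unfolding poly_family_def by (meson image_subset_iff)
  show "f (g x) \<noteq> 0" if "x \<in> T" for x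
    using assms that unfolding poly_family_def by (meson image_subset_iff)
qed

lemma eventually_nhds_in_all:
  "(\<And>y. y \<in> S \<Longrightarrow> Q y) \<Longrightarrow> eventually Q (nhds_in x S)"
  unfolding eventually_inf_principal by (auto intro: always_eventually)

lemma poly_family_locally_matched:
  assumes f: "poly_family S f" and sq: "\<And>x. x \<in> S \<Longrightarrow> rsquarefree (f x)" and x: "x \<in> S"
    and e: "0 < e" "separated (2 * e) (roots (f x))"
  obtains T where "open T" "x \<in> T" "\<And>y. y \<in> T \<inter> S \<Longrightarrow> matched e (roots (f x)) (roots (f y))"
proof -
  have "\<forall>\<^sub>F y in nhds_in x S. matched e (roots (f x)) (roots (f y))"
    using e x sq by (intro poly_tends_matched poly_family_tends[OF f] eventually_nhds_in_all) auto
  then show ?thesis unfolding eventually_nhds_in using that by blast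
qed

lemma separated_of_matched:
  assumes m: "matched e Z W" and sep: "separated (3 * e) Z"
  shows "separated e W"
  unfolding separated_def
proof (intro ballI impI)
  fix w w' assume w: "w \<in> W" "w' \<in> W" "w \<noteq> w'"
  then obtain z z' where z: "z \<in> Z" "dist w z < e" "z' \<in> Z" "dist w' z' < e"
    using m unfolding matched_def by metis
  have "z \<noteq> z'" using m w z unfolding matched_def by metis
  then have "3 * e \<le> dist z z'" using sep z unfolding separated_def by auto
  also have "dist z z' \<le> dist w z + dist w w' + dist w' z'"
    using dist_triangle[of z z' w] dist_triangle[of w z' w'] by (simp add: dist_commute)
  finally show "e \<le> dist w w'" using z by simp
qed

lemma uniformly_separated_on_compact:
  assumes K: "compact K" and f: "poly_family K f" and sq: "\<And>x. x \<in> K \<Longrightarrow> rsquarefree (f x)"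
  obtains c where "0 < c" "\<And>x. x \<in> K \<Longrightarrow> separated c (roots (f x))"
proof -
  have "\<exists>e T. 0 < e \<and> open T \<and> x \<in> T \<and> (\<forall>y\<in>T \<inter> K. separated e (roots (f y)))" if x: "x \<in> K" for x
  proof -
    have "finite (roots (f x))" using f x by (intro poly_roots_finite) (auto simp: poly_family_def)
    then obtain e where e: "0 < e" "separated e (roots (f x))" using ex_separated by blast
    \<comment> \<open>Roots at pairwise distance \<open>e\<close>, each moved by less than
      \<open>e / 3\<close>, remain \<open>e / 3\<close> apart; hence the three parts.\<close>
    then have e': "0 < e / 3" "separated (2 * (e / 3)) (roots (f x))" "separated (3 * (e / 3)) (roots (f x))"
      by (auto intro: separated_mono)
    obtain T where "open T" "x \<in> T" "\<And>y. y \<in> T \<inter> K \<Longrightarrow> matched (e / 3) (roots (f x)) (roots (f y))"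
      using poly_family_locally_matched[OF f sq x e'(1,2)] by blast
    then show ?thesis using e' separated_of_matched by blast
  qed
  then obtain e T where eT: "\<And>x. x \<in> K \<Longrightarrow> 0 < e x" "\<And>x. x \<in> K \<Longrightarrow> open (T x)" "\<And>x. x \<in> K \<Longrightarrow> x \<in> T x"
     "\<And>x y. x \<in> K \<Longrightarrow> y \<in> T x \<inter> K \<Longrightarrow> separated (e x) (roots (f y))"
    by metis
  obtain K' where K': "K' \<subseteq> K" "finite K'" "K \<subseteq> (\<Union>x\<in>K'. T x)"
    using compactE_image[OF K, of K T] eT(2,3) by blast
  define c where "c = Min (insert 1 (e ` K'))"
  have c: "0 < c" "\<And>x. x \<in> K' \<Longrightarrow> c \<le> e x" unfolding c_def using K' eT(1) by auto
  show ?thesis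
  proof (rule that[OF c(1)])
    fix y assume y: "y \<in> K"
    then obtain x where "x \<in> K'" "y \<in> T x" using K' by auto
    then show "separated c (roots (f y))" using eT(4)[of x y] c(2)[of x] K' y
      by (auto intro: separated_mono)
  qed
qed

section \<open>Separation of roots over a puncture\<close>

text \<open>Near a base point \<open>x\<close> each root of \<open>f x\<close> has exactly one
  continuation, so boxes around the finitely many roots are the sheets. Positive degree provides a
  root over every point.\<close>

lemma root_covering_space:
  fixes f :: "complex \<Rightarrow> complex poly"
  assumes f: "poly_family U f" and sq: "\<And>x. x \<in> U \<Longrightarrow> rsquarefree (f x)" and U: "open U"
    and deg: "\<And>x. x \<in> U \<Longrightarrow> 0 < degree (f x)"
  shows "covering_space {(w, y). w \<in> U \<and> poly (f w) y = 0} fst U"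
    (is "covering_space ?C fst U")
proof (rule covering_spaceI)
  show "continuous_on ?C fst" by (intro continuous_intros)
  show "fst ` ?C = U"
  proof
    show "U \<subseteq> fst ` ?C"
    proof
      fix x assume x: "x \<in> U"
      then have "\<not> constant (poly (f x))" using deg[OF x] constant_degree[of "f x"] by simp
      from Fundamental_Theorem_Algebra.fundamental_theorem_of_algebra[OF this] obtain y where "poly (f x) y = 0" by blast
      then show "x \<in> fst ` ?C" using x by force
    qed
  qed auto
  fix x assume x: "x \<in> U"
  have "finite (roots (f x))" using f x by (intro poly_roots_finite) (auto simp: poly_family_def)
  then obtain e0 where e0: "0 < e0" "separated e0 (roots (f x))" using ex_separated by blast
  define e where "e = e0 / 2"
  have e: "0 < e" "separated (2 * e) (roots (f x))" using e0 by (auto simp: e_def)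
  obtain T0 where T0: "open T0" "x \<in> T0" "\<And>y. y \<in> T0 \<inter> U \<Longrightarrow> matched e (roots (f x)) (roots (f y))"
    using poly_family_locally_matched[OF f sq x e] by blast
  define T where "T = T0 \<inter> U"
  define V where "V z = ?C \<inter> (T \<times> ball z e)" for z
  have oT: "open T" unfolding T_def using T0 U by auto
  have far: "2 * e \<le> dist z z'" if "z \<in> roots (f x)" "z' \<in> roots (f x)" "z \<noteq> z'" for z z'
    using e(2) that unfolding separated_def by blast
  show "\<exists>T. x \<in> T \<and> openin (top_of_set U) T \<and>
    (\<exists>v. \<Union> v = ?C \<inter> fst -` T \<and> (\<forall>u\<in>v. openin (top_of_set ?C) u) \<and> pairwise disjnt v \<and>
      (\<forall>u\<in>v. \<exists>q. homeomorphism u T fst q))"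
  proof (intro exI[of _ T] conjI exI[of _ "V ` roots (f x)"])
    show "x \<in> T" using T0 x by (simp add: T_def)
    show "openin (top_of_set U) T" using oT U by (simp add: openin_open_eq T_def)
    show "\<Union> (V ` roots (f x)) = ?C \<inter> fst -` T"
    proof
      show "?C \<inter> fst -` T \<subseteq> \<Union> (V ` roots (f x))"
      proof
        fix u assume u: "u \<in> ?C \<inter> fst -` T"
        obtain w y where uwy: "u = (w, y)" by fastforce
        then have "w \<in> T0 \<inter> U" "y \<in> roots (f w)" using u by (auto simp: T_def)
        then obtain z where "z \<in> roots (f x)" "dist y z < e" using T0(3) unfolding matched_def by blast
        then show "u \<in> \<Union> (V ` roots (f x))" using u uwy by (auto simp: V_def dist_commute)
      qed
    qed (auto simp: V_def)
    show "\<forall>u\<in>V ` roots (f x). openin (top_of_set ?C) u"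
      unfolding V_def using oT by (auto intro!: openin_open_Int open_Times)
    show "pairwise disjnt (V ` roots (f x))"
    proof (rule pairwise_imageI)
      fix z z' assume z: "z \<in> roots (f x)" "z' \<in> roots (f x)" "z \<noteq> z'"
      have False if "dist z y < e" "dist z' y < e" for y
        using far[OF z] dist_triangle2[of z z' y] that by linarith
      then show "disjnt (V z) (V z')" unfolding V_def disjnt_def by auto
    qed
    show "\<forall>u\<in>V ` roots (f x). \<exists>q. homeomorphism u T fst q"
    proof
      fix u assume "u \<in> V ` roots (f x)"
      then obtain z where z: "z \<in> roots (f x)" and u: "u = V z" by auto
      have ex1: "\<exists>!y. y \<in> roots (f w) \<and> dist y z < e" if "w \<in> T" for w
        using T0(3)[of w] that z unfolding T_def matched_def by blast
      define g where "g w = (THE y. y \<in> roots (f w) \<and> dist y z < e)" for w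
      have g: "poly (f w) (g w) = 0" "dist (g w) z < e" if "w \<in> T" for w
        using theI'[OF ex1[OF that]] unfolding g_def by auto
      have g_eq: "y = g w" if "w \<in> T" "poly (f w) y = 0" "dist y z < e" for w y
        using ex1[OF that(1)] g[OF that(1)] that(2,3) by auto
      have cont: "continuous_on T g"
      proof (clarsimp simp: continuous_on_def)
        fix w assume w: "w \<in> T"
        have wU: "w \<in> U" using w by (simp add: T_def)
        show "(g \<longlongrightarrow> g w) (at w within T)"
        proof (rule tendstoI)
          fix d :: real assume "0 < d"
          \<comment> \<open>The radius leaves room inside the ball around \<open>z\<close>: a root
            of \<open>f v\<close> within \<open>d'\<close> of \<open>g w\<close> is still within
            \<open>e\<close> of \<open>z\<close>, so by uniqueness it is \<open>g v\<close>.\<close>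
          define d' where "d' = min d (e - dist (g w) z)"
          have d': "0 < d'" using \<open>0 < d\<close> g(2)[OF w] by (simp add: d'_def)
          have "\<forall>\<^sub>F v in nhds_in w U. \<exists>y. poly (f v) y = 0 \<and> dist y (g w) < d'"
            using poly_tends_root_near[OF poly_family_tends[OF f wU] g(1)[OF w] d'] .
          then have "\<forall>\<^sub>F v in at w within T. \<exists>y. poly (f v) y = 0 \<and> dist y (g w) < d'"
            unfolding at_within_def by (rule filter_leD[rotated]) (intro inf_mono order_refl, auto simp: T_def)
          moreover have "\<forall>\<^sub>F v in at w within T. v \<in> T" by (simp add: eventually_at_topological) blast
          ultimately show "\<forall>\<^sub>F v in at w within T. dist (g v) (g w) < d"
          proof eventually_elim
            case (elim v)
            then obtain y where y: "poly (f v) y = 0" "dist y (g w) < d'" by blast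
            then have "dist y z < e" using dist_triangle[of y z "g w"] by (simp add: d'_def)
            then have "y = g v" using g_eq elim y by blast
            then show ?case using y by (simp add: d'_def)
          qed
        qed
      qed
      show "\<exists>q. homeomorphism u T fst q"
      proof (intro exI[of _ "\<lambda>w. (w, g w)"], unfold homeomorphism_def, intro conjI)
        show "\<forall>x\<in>u. (fst x, g (fst x)) = x"
          unfolding u V_def using g_eq by (auto simp: dist_commute)
        show "fst ` u = T" unfolding u V_def using g by (force simp: T_def dist_commute)
        show "(\<lambda>w. (w, g w)) ` T = u"
          unfolding u V_def using g g_eq by (auto simp: T_def dist_commute image_iff)
        show "continuous_on u fst" "continuous_on T (\<lambda>w. (w, g w))" "\<forall>y\<in>T. fst (y, g y) = y"
          by (auto intro!: continuous_intros cont)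
      qed
    qed
  qed
qed

text \<open>A convex base is simply connected, so the identity lifts to the covering of roots from
  any starting root. Lifts that agree at one point agree everywhere, hence branches with different
  starting values never meet.\<close>

lemma root_branches:
  fixes f :: "complex \<Rightarrow> complex poly"
  assumes f: "poly_family U f" and sq: "\<And>x. x \<in> U \<Longrightarrow> rsquarefree (f x)" and U: "open U" "convex U"
    and w0: "w0 \<in> U" "poly (f w0) a = 0" "poly (f w0) b = 0" "a \<noteq> b"
  obtains Y1 Y2 where "continuous_on U Y1" "continuous_on U Y2" "Y1 w0 = a" "Y2 w0 = b"
    "\<And>w. w \<in> U \<Longrightarrow> poly (f w) (Y1 w) = 0" "\<And>w. w \<in> U \<Longrightarrow> poly (f w) (Y2 w) = 0"
    "\<And>w. w \<in> U \<Longrightarrow> Y1 w \<noteq> Y2 w"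
proof -
  let ?C = "{(w, y). w \<in> U \<and> poly (f w) y = 0}"
  have f0: "f w0 \<noteq> 0" using f w0 by (auto simp: poly_family_def)
  have "0 < degree (f w0)"
  proof (rule ccontr)
    assume "\<not> ?thesis"
    then obtain c where "f w0 = [:c:]" by (metis degree_eq_zeroE gr0I)
    then show False using f0 w0(2) by simp
  qed
  then have deg: "0 < degree (f x)" if "x \<in> U" for x
    using f w0(1) that unfolding poly_family_def by metis
  have cov: "covering_space ?C fst U" by (rule root_covering_space[OF f sq U(1) deg])
  have lift: "\<exists>g. continuous_on U g \<and> g \<in> U \<rightarrow> ?C \<and> g w0 = (w0, y) \<and> (\<forall>w\<in>U. fst (g w) = w)"
    if "poly (f w0) y = 0" for y
    by (rule covering_space_lift_strong[OF cov, of "(w0, y)" w0 U "\<lambda>w. w"])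
      (use that w0 U in \<open>auto simp: convex_imp_simply_connected intro!: open_imp_locally_path_connected continuous_on_id\<close>)
  obtain g1 where g1: "continuous_on U g1" "g1 \<in> U \<rightarrow> ?C" "g1 w0 = (w0, a)" "\<And>w. w \<in> U \<Longrightarrow> fst (g1 w) = w"
    using lift[OF w0(2)] by blast
  obtain g2 where g2: "continuous_on U g2" "g2 \<in> U \<rightarrow> ?C" "g2 w0 = (w0, b)" "\<And>w. w \<in> U \<Longrightarrow> fst (g2 w) = w"
    using lift[OF w0(3)] by blast
  have root: "poly (f w) (snd (g w)) = 0"
    if "g \<in> U \<rightarrow> ?C" "w \<in> U" "fst (g w) = w" for g :: "complex \<Rightarrow> complex \<times> complex" and w
  proof -
    have "g w \<in> ?C" using that(1,2) by (rule funcset_mem)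
    then show ?thesis using that(3) by (cases "g w") auto
  qed
  show ?thesis
  proof (rule that[of "\<lambda>w. snd (g1 w)" "\<lambda>w. snd (g2 w)"])
    fix w assume w: "w \<in> U"
    show "snd (g1 w) \<noteq> snd (g2 w)"
    proof
      assume "snd (g1 w) = snd (g2 w)"
      then have eq: "g1 w = g2 w" using g1(4)[OF w] g2(4)[OF w] by (simp add: prod_eq_iff)
      have "g1 w0 = g2 w0"
        by (rule covering_space_lift_unique[where f = "\<lambda>w. w" and T = U and a = w and ?g1.0 = g1 and ?g2.0 = g2, OF cov eq])
          (use g1 g2 w w0 U in \<open>auto simp: convex_connected\<close>)
      then show False using g1 g2 w0 by simp
    qed
  qed (use g1 g2 root in \<open>auto intro!: continuous_intros\<close>)
qed

text \<open>The difference of the values of \<open>f w\<close> at \<open>Y w\<close> and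
  \<open>Y w0\<close> factors as \<open>(Y w - Y w0) * G w\<close>, where \<open>G w0\<close> is the
  derivative of \<open>f w0\<close> at a simple root and so nonzero. Since \<open>Y w\<close> is a
  root of \<open>f w\<close>, the difference quotient of \<open>Y\<close> is that of
  \<open>- E\<close> divided by \<open>G w\<close>.\<close>

lemma root_branch_holomorphic:
  fixes f :: "complex \<Rightarrow> complex poly"
  assumes f: "poly_family U f" and sq: "\<And>x. x \<in> U \<Longrightarrow> rsquarefree (f x)" and U: "open U"
    and hol: "\<And>i. (\<lambda>w. coeff (f w) i) holomorphic_on U"
    and Y: "continuous_on U Y" "\<And>w. w \<in> U \<Longrightarrow> poly (f w) (Y w) = 0"
  shows "Y holomorphic_on U"
proof -
  have "Y field_differentiable (at w0)" if w0: "w0 \<in> U" for w0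
  proof -
    let ?n = "degree (f w0)" and ?y = "Y w0"
    have deg: "degree (f w) = ?n" if "w \<in> U" for w
      using f that w0 unfolding poly_family_def by blast
    define G where "G w = (\<Sum>i\<le>?n. coeff (f w) i * (\<Sum>j<i. ?y ^ (i - Suc j) * Y w ^ j))" for w
    define E where "E w = (\<Sum>i\<le>?n. coeff (f w) i * ?y ^ i)" for w
    have E_eq: "E w = poly (f w) ?y" if "w \<in> U" for w
      unfolding E_def using deg[OF that] by (simp add: poly_altdef)
    have Ed: "E field_differentiable (at w0)" unfolding E_def
      using hol U w0 by (intro derivative_intros) (auto simp: holomorphic_on_open field_differentiable_def)
    then obtain E' where E': "(E has_field_derivative E') (at w0)" unfolding field_differentiable_def by blast
    have "G w0 = (\<Sum>i\<le>?n. coeff (f w0) i * (of_nat i * ?y ^ (i - 1)))"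
    proof (unfold G_def, intro sum.cong refl arg_cong2[where f = "(*)"])
      fix i
      have "(\<Sum>j<i. ?y ^ (i - Suc j) * ?y ^ j) = (\<Sum>j<i. ?y ^ (i - 1))"
        by (intro sum.cong refl) (simp flip: power_add)
      then show "(\<Sum>j<i. ?y ^ (i - Suc j) * ?y ^ j) = of_nat i * ?y ^ (i - 1)" by simp
    qed
    also have "\<dots> = poly (pderiv (f w0)) ?y"
    proof -
      have "((\<lambda>y. \<Sum>i\<le>?n. coeff (f w0) i * y ^ i) has_field_derivative
          (\<Sum>i\<le>?n. coeff (f w0) i * (of_nat i * ?y ^ (i - 1)))) (at ?y)"
        by (auto intro!: derivative_eq_intros sum.cong)
      moreover have "((\<lambda>y. \<Sum>i\<le>?n. coeff (f w0) i * y ^ i) has_field_derivative poly (pderiv (f w0)) ?y) (at ?y)"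
        using poly_DERIV[of "f w0" ?y] by (simp add: poly_altdef[of "f w0"])
      ultimately show ?thesis by (rule DERIV_unique)
    qed
    finally have G0: "G w0 \<noteq> 0" using sq[OF w0] Y(2)[OF w0] by (simp add: rsquarefree_roots)
    have "continuous_on U G" unfolding G_def
      using f Y(1) by (intro continuous_intros) (auto simp: poly_family_def)
    then have G: "G \<midarrow>w0\<rightarrow> G w0" using U w0 by (simp add: continuous_on_eq_continuous_at isCont_def)
    have key: "(Y w - ?y) * G w = - (E w - E w0)" if w: "w \<in> U" for w
    proof -
      have "(Y w - ?y) * G w = (\<Sum>i\<le>?n. coeff (f w) i * (Y w ^ i - ?y ^ i))"
        unfolding G_def sum_distrib_left power_diff_sumr2 by (intro sum.cong refl) (simp add: mult_ac sum_distrib_left)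
      also have "\<dots> = poly (f w) (Y w) - E w"
        unfolding E_def using deg[OF w] by (simp add: poly_altdef algebra_simps sum_subtractf)
      finally show ?thesis using Y(2) w w0 E_eq by simp
    qed
    have "((\<lambda>w. - ((E w - E w0) / (w - w0)) / G w) \<longlongrightarrow> - E' / G w0) (at w0)"
      using E' G G0 unfolding has_field_derivative_iff by (intro tendsto_intros) auto
    moreover have "\<forall>\<^sub>F w in at w0. - ((E w - E w0) / (w - w0)) / G w = (Y w - ?y) / (w - w0)"
    proof -
      have "\<forall>\<^sub>F w in at w0. w \<in> U" using U w0 by (rule eventually_at_in_open')
      moreover have "\<forall>\<^sub>F w in at w0. G w \<noteq> 0" using G G0 by (rule tendsto_imp_eventually_ne)
      ultimately show ?thesis
      proof eventually_elim
        case (elim w)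
        then have "- (E w - E w0) / G w = Y w - ?y" using key[of w] by (simp add: field_simps)
        then show ?case by (metis divide_divide_eq_left divide_minus_left mult.commute)
      qed
    qed
    ultimately have "((\<lambda>w. (Y w - ?y) / (w - w0)) \<longlongrightarrow> - E' / G w0) (at w0)"
      by (rule Lim_transform_eventually)
    then show ?thesis unfolding field_differentiable_def has_field_derivative_iff by blast
  qed
  then show ?thesis using U by (simp add: holomorphic_on_def field_differentiable_at_within)
qed

text \<open>Phragmen-Lindelof: the maximum principle on half-discs is applied to \<open>h ^ k / (w - A)\<close>,
  which tends to \<open>0\<close> at infinity; then \<open>k \<rightarrow> \<infinity>\<close>.\<close>

lemma bounded_half_plane_maximum:
  fixes h :: "complex \<Rightarrow> complex"
  assumes hol: "h holomorphic_on {w. Re w < b}" and ab: "a < b"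
    and bd: "\<And>w. Re w \<le> a \<Longrightarrow> norm (h w) \<le> K"
    and line: "\<And>w. Re w = a \<Longrightarrow> norm (h w) \<le> B" and B: "0 < B"
    and w: "Re w < a"
  shows "norm (h w) \<le> B"
proof -
  \<comment> \<open>The pole sits to the right of the line, so that \<open>v - A\<close> has modulus
    at least 1 on the whole closed half-plane.\<close>
  define A where "A = complex_of_real (a + 1)"
  have A: "1 \<le> norm (v - A)" if "Re v \<le> a" for v
    using that abs_Re_le_cmod[of "v - A"] by (simp add: A_def)
  have key: "(norm (h w) / B) ^ k \<le> norm (w - A)" for k
  proof -
    \<comment> \<open>The first entry puts \<open>w\<close> inside the disc; the second makes the
      denominator on the arc large enough to turn the crude bound \<open>K\<close> into
      \<open>B ^ k\<close>.\<close>
    define L where "L = max (norm (w - A) + 1) ((max K 0 / B) ^ k)"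
    define S where "S = {v. Re v < a} \<inter> ball A L"
    have oS: "open S" unfolding S_def by (intro open_Int open_halfspace_Re_lt open_ball)
    have cl: "closure S \<subseteq> {v. Re v \<le> a} \<inter> cball A L"
      by (rule closure_minimal) (auto simp: S_def intro!: closed_Int closed_halfspace_Re_le)
    have cont: "continuous_on {w. Re w < b} h" using hol by (rule holomorphic_on_imp_continuous_on)
    define g where "g v = h v ^ k / (v - A)" for v
    have "norm (g w) \<le> B ^ k"
    proof (rule maximum_modulus_frontier[of g S])
      show "g holomorphic_on interior S" unfolding g_def interior_open[OF oS]
      proof (intro holomorphic_intros holomorphic_on_subset[OF hol])
        show "S \<subseteq> {w. Re w < b}" using ab by (auto simp: S_def)
        show "v - A \<noteq> 0" if "v \<in> S" for v using A[of v] that by (auto simp: S_def)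
      qed
      show "continuous_on (closure S) g" unfolding g_def
        by (intro continuous_intros continuous_on_subset[OF cont]) (use A ab cl in force)+
      show "bounded S" unfolding S_def by (intro bounded_Int) auto
      have "norm (w - A) < L" unfolding L_def by simp
      then show "w \<in> S" using w by (simp add: S_def dist_norm norm_minus_commute)
      fix v assume v: "v \<in> frontier S"
      then have v': "Re v \<le> a" "dist A v \<le> L" "v \<notin> S"
        using cl oS by (auto simp: frontier_def interior_open)
      have gv: "norm (g v) = norm (h v) ^ k / norm (v - A)" by (simp add: g_def norm_divide norm_power)
      have pos: "0 < norm (v - A)" using A[OF v'(1)] by linarith
      show "norm (g v) \<le> B ^ k"
      proof (cases "Re v = a")
        case True
        have "norm (h v) ^ k \<le> B ^ k" using line[OF True] by (intro power_mono) auto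
        also have "\<dots> \<le> B ^ k * norm (v - A)" using A[OF v'(1)] B by simp
        finally show ?thesis unfolding gv using pos by (simp add: field_simps)
      next
        case False
        then have "norm (v - A) = L" using v' by (auto simp: S_def dist_norm norm_minus_commute)
        then have "(max K 0 / B) ^ k \<le> norm (v - A)" by (simp add: L_def)
        then have "max K 0 ^ k \<le> B ^ k * norm (v - A)" using B by (simp add: field_simps power_divide)
        moreover have "norm (h v) ^ k \<le> max K 0 ^ k"
          using bd[OF v'(1)] by (intro power_mono) auto
        ultimately show ?thesis unfolding gv using pos by (simp add: field_simps)
      qed
    qed
    then show ?thesis using A[of w] w B
      by (simp add: g_def norm_divide norm_power power_divide divide_simps split: if_splits) (simp add: mult_ac)
  qed
  show ?thesis
  proof (rule ccontr)
    assume "\<not> ?thesis"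
    then have "1 < norm (h w) / B" using B by simp
    then obtain k where "norm (w - A) < (norm (h w) / B) ^ k" using real_arch_pow by blast
    then show False using key[of k] by simp
  qed
qed

text \<open>The balls of radius \<open>e\<close> around the separated points of \<open>Z\<close> are
  disjoint and cover the connected image, which therefore stays in the ball where it starts.\<close>

lemma connected_image_in_ball:
  fixes g :: "'b::topological_space \<Rightarrow> 'a::metric_space"
  assumes S: "connected S" and g: "continuous_on S g"
    and cover: "\<And>s. s \<in> S \<Longrightarrow> \<exists>z\<in>Z. dist (g s) z < e"
    and sep: "separated (2 * e) Z" and s0: "s0 \<in> S" "z0 \<in> Z" "dist (g s0) z0 < e"
    and s: "s \<in> S"
  shows "dist (g s) z0 < e"
proof -
  define B where "B = (\<Union>z\<in>Z - {z0}. ball z e)"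
  have con: "connected (g ` S)" using S g by (intro connected_continuous_image)
  have "ball z0 e \<inter> B = {}"
  proof -
    have False if "z \<in> Z" "z \<noteq> z0" "dist z0 y < e" "dist z y < e" for z y
      using sep s0(2) that dist_triangle2[of z0 z y] unfolding separated_def by fastforce
    then show ?thesis unfolding B_def disjoint_iff by (metis DiffE UN_E mem_ball singletonI)
  qed
  moreover have "g ` S \<subseteq> ball z0 e \<union> B" using cover unfolding B_def by (fastforce simp: dist_commute)
  moreover have "ball z0 e \<inter> g ` S \<noteq> {}" using s0 by (auto simp: dist_commute)
  moreover have "open B" unfolding B_def by auto
  ultimately have "B \<inter> g ` S = {}" using connectedD[OF con, of "ball z0 e" B] by auto
  then have "g s \<in> ball z0 e" using \<open>g ` S \<subseteq> ball z0 e \<union> B\<close> s by blast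
  then show ?thesis by (simp add: dist_commute)
qed

text \<open>In the logarithmic coordinate \<open>x = \<beta> + exp w\<close> the roots are global branches \<open>Y\<^sub>1, Y\<^sub>2\<close> on a
  half-plane, and \<open>1 / (Y\<^sub>1 - Y\<^sub>2)\<close> is bounded there; so its bound on the circle is a bound near
  \<open>\<beta>\<close>.\<close>

lemma separated_at_centre:
  fixes P :: "complex \<Rightarrow> complex poly"
  assumes fam: "poly_family (ball \<beta> R) P"
    and hol: "\<And>i. (\<lambda>x. coeff (P x) i) holomorphic_on ball \<beta> R"
    and sq: "\<And>x. x \<in> ball \<beta> R \<Longrightarrow> x \<noteq> \<beta> \<Longrightarrow> rsquarefree (P x)"
    and r: "0 < r" "r < R" and c: "0 < c"
    and circle: "\<And>x. dist \<beta> x = r \<Longrightarrow> separated c (roots (P x))"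
  shows "separated c (roots (P \<beta>))"
  unfolding separated_def
proof (intro ballI impI, rule ccontr)
  fix y1 y2 assume y: "y1 \<in> roots (P \<beta>)" "y2 \<in> roots (P \<beta>)" "y1 \<noteq> y2" and less: "\<not> c \<le> dist y1 y2"
  have \<beta>: "\<beta> \<in> ball \<beta> R" using r by simp
  have "finite (roots (P \<beta>))" using fam \<beta> by (intro poly_roots_finite) (auto simp: poly_family_def)
  then obtain e0 where e0: "0 < e0" "separated e0 (roots (P \<beta>))" using ex_separated by blast
  \<comment> \<open>The first bound keeps branches near \<open>y1\<close> and \<open>y2\<close> at
    least \<open>2 * e\<close> apart. The second ensures that roots within \<open>e\<close> of
    \<open>y1\<close> and \<open>y2\<close> are still less than \<open>c\<close> apart, which yields
    the final contradiction.\<close>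
  define e where "e = min (e0 / 4) ((c - dist y1 y2) / 4)"
  have "0 < e" "e \<le> e0 / 4" "e \<le> (c - dist y1 y2) / 4"
    unfolding e_def using e0 less by (simp, intro min.cobounded1, intro min.cobounded2)
  then have e: "0 < e" "4 * e \<le> e0" "2 * e < c - dist y1 y2" by auto
  have sep4: "separated (4 * e) (roots (P \<beta>))" using e0(2) e(2) by (rule separated_mono)
  have sep2: "separated (2 * e) (roots (P \<beta>))" using sep4 e(1) by (auto intro: separated_mono)
  have y12: "4 * e \<le> dist y1 y2" using sep4 y unfolding separated_def by blast
  note tends = poly_family_tends[OF fam \<beta>]
  have "\<forall>\<^sub>F x in nhds_in \<beta> (ball \<beta> R). (\<forall>w. poly (P x) w = 0 \<longrightarrow> (\<exists>z. poly (P \<beta>) z = 0 \<and> dist w z < e)) \<and>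
      (\<exists>w. poly (P x) w = 0 \<and> dist w y1 < e) \<and> (\<exists>w. poly (P x) w = 0 \<and> dist w y2 < e)"
    using y by (intro eventually_conj poly_tends_roots_within[OF tends e(1)] poly_tends_root_near[OF tends _ e(1)]) auto
  then obtain T where T: "open T" "\<beta> \<in> T"
     "\<And>x w. x \<in> T \<inter> ball \<beta> R \<Longrightarrow> poly (P x) w = 0 \<Longrightarrow> \<exists>z\<in>roots (P \<beta>). dist w z < e"
     "\<And>x. x \<in> T \<inter> ball \<beta> R \<Longrightarrow> \<exists>w. poly (P x) w = 0 \<and> dist w y1 < e"
     "\<And>x. x \<in> T \<inter> ball \<beta> R \<Longrightarrow> \<exists>w. poly (P x) w = 0 \<and> dist w y2 < e"
    unfolding eventually_nhds_in by auto
  obtain d0 where d0: "0 < d0" "ball \<beta> d0 \<subseteq> T" using T(1,2) open_contains_ball by blast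
  define d where "d = min d0 r"
  have d: "0 < d" "d \<le> r" "ball \<beta> d \<subseteq> T \<inter> ball \<beta> R" using d0 r by (auto simp: d_def)
  \<comment> \<open>The exponential wraps this half-plane around the disc of radius \<open>R\<close>
    punctured at its centre; on the simply connected half-plane the roots have no monodromy.\<close>
  define U where "U = {w. Re w < ln R}"
  define x where "x w = \<beta> + exp w" for w
  have xd: "dist \<beta> (x w) = exp (Re w)" for w by (simp add: x_def dist_norm)
  have xU: "x w \<in> ball \<beta> R" "x w \<noteq> \<beta>" if "w \<in> U" for w
  proof -
    have "exp (Re w) < exp (ln R)" using that unfolding U_def by (subst exp_less_cancel_iff) simp
    then show "x w \<in> ball \<beta> R" using r xd by simp
  qed (simp add: x_def)
  have oU: "open U" "convex U" unfolding U_def by (rule open_halfspace_Re_lt, rule convex_halfspace_Re_lt)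
  have famU: "poly_family U (\<lambda>w. P (x w))"
    by (rule poly_family_compose[OF fam]) (use xU in \<open>auto simp: x_def intro!: continuous_intros\<close>)
  have sqU: "rsquarefree (P (x w))" if "w \<in> U" for w using sq xU[OF that] by blast
  have holU: "(\<lambda>w. coeff (P (x w)) i) holomorphic_on U" for i
  proof -
    have "x holomorphic_on U" unfolding x_def by (intro holomorphic_intros)
    then have "((\<lambda>x. coeff (P x) i) \<circ> x) holomorphic_on U"
      using xU by (intro holomorphic_on_compose_gen[OF _ hol]) auto
    then show ?thesis by (simp add: o_def)
  qed
  define w0 where "w0 = complex_of_real (ln (d / 2))"
  have lnr: "ln (d / 2) < ln r" "ln r < ln R" using d r by auto
  have w0: "w0 \<in> U" using lnr by (simp add: U_def w0_def)
  have "dist \<beta> (x w0) < d" using d(1) by (simp add: xd w0_def)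
  then have x0: "x w0 \<in> T \<inter> ball \<beta> R" using d(3) by auto
  obtain u1 where u1: "poly (P (x w0)) u1 = 0" "dist u1 y1 < e" using T(4)[OF x0] by blast
  obtain u2 where u2: "poly (P (x w0)) u2 = 0" "dist u2 y2 < e" using T(5)[OF x0] by blast
  have tri: "dist y1 y2 \<le> dist v1 y1 + dist v1 v2 + dist v2 y2" "dist v1 v2 \<le> dist v1 y1 + dist y1 y2 + dist v2 y2"
    for v1 v2 :: complex
    using dist_triangle[of y1 y2 v1] dist_triangle[of v1 y2 v2] dist_triangle[of v1 v2 y1] dist_triangle[of y1 v2 y2]
    by (simp_all add: dist_commute)
  have "u1 \<noteq> u2" using tri(1)[of u1 u2] u1 u2 y12 e(1) by auto
  then obtain Y1 Y2 where Y: "continuous_on U Y1" "continuous_on U Y2" "Y1 w0 = u1" "Y2 w0 = u2"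
    "\<And>w. w \<in> U \<Longrightarrow> poly (P (x w)) (Y1 w) = 0" "\<And>w. w \<in> U \<Longrightarrow> poly (P (x w)) (Y2 w) = 0"
    "\<And>w. w \<in> U \<Longrightarrow> Y1 w \<noteq> Y2 w"
    using root_branches[OF famU sqU oU w0 u1(1) u2(1)] by metis
  define h where "h w = 1 / (Y1 w - Y2 w)" for w
  have h: "h holomorphic_on {w. Re w < ln R}"
    unfolding h_def U_def[symmetric] using Y
    by (intro holomorphic_intros root_branch_holomorphic[OF famU sqU oU(1) holU]) auto
  have h_le: "norm (h w) \<le> 1 / k" if "0 < k" "k \<le> dist (Y1 w) (Y2 w)" for w k
    using that by (simp add: h_def norm_divide dist_norm frac_le)
  \<comment> \<open>The separation \<open>c'\<close> on this annulus may be arbitrarily small: it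
    serves only to show that \<open>h\<close> is bounded at all. Closer to the centre the bound
    comes from the distance of \<open>y1\<close> and \<open>y2\<close>.\<close>
  let ?A = "{x. d / 2 \<le> dist \<beta> x \<and> dist \<beta> x \<le> r}"
  have "?A = cball \<beta> r - ball \<beta> (d / 2)" by auto
  then have cA: "compact ?A" by (simp add: compact_diff)
  have "?A \<subseteq> ball \<beta> R" using r by auto
  then have famA: "poly_family ?A P" by (rule poly_family_subset[OF fam])
  have sqA: "rsquarefree (P x)" if "x \<in> ?A" for x using that d r by (intro sq) auto
  obtain c' where c': "0 < c'" "\<And>x. x \<in> ?A \<Longrightarrow> separated c' (roots (P x))"
    using uniformly_separated_on_compact[OF cA famA sqA] by blast
  define V where "V = {w. Re w < ln d}"
  have V: "connected V" "V \<subseteq> U" "w0 \<in> V"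
  proof -
    show "connected V" unfolding V_def by (intro convex_connected convex_halfspace_Re_lt)
    have "ln d \<le> ln R" using d r by simp
    then show "V \<subseteq> U" unfolding V_def U_def by auto
    show "w0 \<in> V" unfolding V_def w0_def using d by simp
  qed
  have xV: "x w \<in> T \<inter> ball \<beta> R" if "w \<in> V" for w
  proof -
    have "exp (Re w) < exp (ln d)" using that unfolding V_def by (subst exp_less_cancel_iff) simp
    then have "x w \<in> ball \<beta> d" using d xd[of w] by simp
    then show ?thesis using d(3) by blast
  qed
  \<comment> \<open>The branches start near \<open>y1\<close> and \<open>y2\<close>, and over the
    small punctured disc every root is near some root over the centre; connectedness of
    \<open>V\<close> keeps each branch where it started.\<close>
  have near: "dist (Y1 w) y1 < e" "dist (Y2 w) y2 < e" if "w \<in> V" for w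
    by (rule connected_image_in_ball[OF V(1) continuous_on_subset[OF Y(1) V(2)] _ sep2 V(3) y(1) _ that];
        use Y u1 T(3) xV V(2) in blast)
       (rule connected_image_in_ball[OF V(1) continuous_on_subset[OF Y(2) V(2)] _ sep2 V(3) y(2) _ that];
        use Y u2 T(3) xV V(2) in blast)
  \<comment> \<open>The line \<open>Re w = ln r\<close> lies over the circle of radius
    \<open>r\<close>, so the bound obtained depends on the circle alone.\<close>
  have "norm (h w0) \<le> 1 / c"
  proof (rule bounded_half_plane_maximum[OF h lnr(2)])
    fix w assume w: "Re w \<le> ln r"
    then have wU: "w \<in> U" using lnr by (simp add: U_def)
    have "exp (Re w) \<le> exp (ln r)" using w by (subst exp_le_cancel_iff)
    then have xr: "dist \<beta> (x w) \<le> r" using r xd by simp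
    show "norm (h w) \<le> max (1 / c') (1 / (2 * e))"
    proof (cases "w \<in> V")
      case True
      have "2 * e \<le> dist (Y1 w) (Y2 w)" using near[OF True] tri(1)[of "Y1 w" "Y2 w"] y12 by simp
      then show ?thesis using h_le[of "2 * e" w] e(1) by simp
    next
      case False
      then have "exp (ln d) \<le> exp (Re w)" unfolding V_def by (subst exp_le_cancel_iff) simp
      then have "x w \<in> ?A" using xr xd d(1) by simp
      then have "c' \<le> dist (Y1 w) (Y2 w)" using c'(2) Y(5-7)[OF wU] unfolding separated_def by blast
      then show ?thesis using h_le[of c' w] c'(1) by simp
    qed
  next
    fix w assume w: "Re w = ln r"
    then have wU: "w \<in> U" using lnr by (simp add: U_def)
    have "dist \<beta> (x w) = r" using w r xd by simp
    then have "c \<le> dist (Y1 w) (Y2 w)" using circle Y(5-7)[OF wU] unfolding separated_def by blast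
    then show "norm (h w) \<le> 1 / c" using h_le c by simp
  qed (use c lnr in \<open>auto simp: w0_def\<close>)
  then have "1 / dist u1 u2 \<le> 1 / c" by (simp add: h_def norm_divide dist_norm Y(3,4))
  then have "c \<le> dist u1 u2" using c \<open>u1 \<noteq> u2\<close> by (simp add: field_simps)
  then show False using tri(2)[of u1 u2] u1 u2 e by simp
qed

text \<open>Enlarging the radius adds no partner: each point of \<open>W\<close> is within
  \<open>d\<close> of some point of \<open>Z\<close>, and separation of \<open>Z\<close> leaves only
  one candidate within \<open>e\<close>.\<close>

lemma matched_mono:
  assumes m: "matched d Z W" and sep: "separated (2 * e) Z" and d: "d \<le> e"
  shows "matched e Z W"
proof -
  have eq: "z = z'" if "z \<in> Z" "z' \<in> Z" "dist w z < e" "dist w z' < e" for w z z'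
    using sep that dist_triangle2[of z z' w] unfolding separated_def by (fastforce simp: dist_commute)
  have "w = w'" if w: "w \<in> W" "w' \<in> W" and z: "z \<in> Z" "dist w z < e" "dist w' z < e" for w w' z
  proof -
    obtain z1 z2 where zz: "z1 \<in> Z" "dist w z1 < d" "z2 \<in> Z" "dist w' z2 < d"
      using m w unfolding matched_def by metis
    then have "z1 = z" "z2 = z" using eq z d by (meson less_le_trans)+
    then show ?thesis using m w zz unfolding matched_def by blast
  qed
  then show ?thesis using m d unfolding matched_def by (meson less_le_trans)
qed

text \<open>\<open>m q\<close> plays the part of \<open>M(x, q)\<close> and \<open>P q x\<close>
  that of \<open>F(x, y, q)\<close> as polynomial in \<open>y\<close>.\<close>

locale equisingular_family =
  fixes L :: "'q::euclidean_space set" and m :: "'q \<Rightarrow> complex poly" and P :: "'q \<Rightarrow> complex \<Rightarrow> complex poly"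
  assumes open_L: "open L"
    and m_family: "poly_family L m"
    and m_simple: "q \<in> L \<Longrightarrow> rsquarefree (m q)"
    and m_real: "q \<in> L \<Longrightarrow> real_coeffs (m q)"
    and P_family: "poly_family (L \<times> UNIV) (\<lambda>(q, x). P q x)"
    and P_holomorphic: "q \<in> L \<Longrightarrow> (\<lambda>x. coeff (P q x) i) holomorphic_on UNIV"
    and P_real: "q \<in> L \<Longrightarrow> real_coeffs (P q (of_real t))"
    and P_simple: "q \<in> L \<Longrightarrow> poly (m q) x \<noteq> 0 \<Longrightarrow> rsquarefree (P q x)"
begin

lemma finite_roots_m: "q \<in> L \<Longrightarrow> finite (roots (m q))"
  using m_family by (intro poly_roots_finite) (auto simp: poly_family_def)

lemma finite_roots_P: "q \<in> L \<Longrightarrow> finite (roots (P q x))"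
  using P_family by (intro poly_roots_finite) (auto simp: poly_family_def)

lemma P_family_at:
  assumes "q \<in> L"
  shows "poly_family S (P q)"
proof -
  have "continuous_on S (\<lambda>x. (q, x))" by (intro continuous_intros)
  moreover have "(\<lambda>x. (q, x)) ` S \<subseteq> L \<times> UNIV" using assms by auto
  ultimately have "poly_family S (\<lambda>x. case (q, x) of (q, x) \<Rightarrow> P q x)"
    by (rule poly_family_compose[OF P_family])
  then show ?thesis by simp
qed

text \<open>The constant \<open>c\<close> is obtained once, by compactness, for all nearby
  parameters and an annulus around \<open>a\<close>. That annulus contains the circle of radius
  \<open>r\<close> around every nearby critical value \<open>b\<close>, from where
  \<open>separated_at_centre\<close> carries \<open>c\<close> to the fibre over
  \<open>b\<close>.\<close>

lemma critical_separated:
  assumes p: "p \<in> L" and a: "poly (m p) a = 0"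
  obtains c d r where "0 < c" "0 < d" "0 < r" "ball p d \<subseteq> L"
    "\<And>q b. q \<in> ball p d \<Longrightarrow> b \<in> ball a r \<Longrightarrow> poly (m q) b = 0 \<Longrightarrow> separated c (roots (P q b))"
proof -
  obtain e0 where e0: "0 < e0" "separated e0 (roots (m p))" using ex_separated[OF finite_roots_m[OF p]] by blast
  \<comment> \<open>Critical values at \<open>p\<close> are \<open>8 * r\<close> apart and move by
    less than \<open>r / 2\<close>. With \<open>b\<close> within \<open>r / 2\<close> of
    \<open>a\<close>, the circle of radius \<open>r\<close> around \<open>b\<close> lies in the
    annulus, and the disc of radius \<open>2 * r\<close> around \<open>b\<close> stays within
    \<open>3 * r\<close> of \<open>a\<close> and contains no critical value besides
    \<open>b\<close>.\<close>
  define r where "r = e0 / 8"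
  have r: "0 < r" using e0 by (simp add: r_def)
  have sep: "separated (8 * r) (roots (m p))" using e0 by (simp add: r_def)
  then have sep1: "separated (2 * (r / 2)) (roots (m p))" using r by (auto intro: separated_mono)
  obtain T where T: "open T" "p \<in> T" "\<And>q. q \<in> T \<inter> L \<Longrightarrow> matched (r / 2) (roots (m p)) (roots (m q))"
    using poly_family_locally_matched[OF m_family m_simple p _ sep1] r by auto
  obtain d where d: "0 < d" "cball p d \<subseteq> T \<inter> L"
    using open_Int[OF T(1) open_L] T(2) p open_contains_cball by blast
  let ?A = "{x. r / 2 \<le> dist a x \<and> dist a x \<le> 2 * r}"
  have near: "z = a" if "poly (m p) z = 0" "dist x z < r / 2" "dist a x < 3 * r" for z x
  proof (rule ccontr)
    assume "z \<noteq> a"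
    then have "8 * r \<le> dist a z" using sep that a unfolding separated_def by force
    also have "\<dots> \<le> dist a x + dist x z" by (rule dist_triangle)
    finally show False using that r by simp
  qed
  have nz: "poly (m q) x \<noteq> 0" if q: "q \<in> cball p d" and x: "r / 2 \<le> dist a x" "dist a x < 3 * r" for q x
  proof
    assume "poly (m q) x = 0"
    then obtain z where z: "z \<in> roots (m p)" "dist x z < r / 2"
      using T(3)[of q] q d unfolding matched_def by blast
    then show False using near[OF _ z(2) x(2)] x by (simp add: dist_commute)
  qed
  have "?A = cball a (2 * r) - ball a (r / 2)" by auto
  then have comp: "compact (cball p d \<times> ?A)" by (simp add: compact_diff compact_Times)
  have fam: "poly_family (cball p d \<times> ?A) (\<lambda>(q, x). P q x)"
    using d by (intro poly_family_subset[OF P_family]) auto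
  have sq: "rsquarefree ((\<lambda>(q, x). P q x) u)" if "u \<in> cball p d \<times> ?A" for u
  proof -
    obtain q x where u: "u = (q, x)" by fastforce
    then have "poly (m q) x \<noteq> 0" using that r by (intro nz) auto
    moreover have "q \<in> L" using that u d by auto
    ultimately show ?thesis using P_simple u by simp
  qed
  obtain c where c: "0 < c" "\<And>u. u \<in> cball p d \<times> ?A \<Longrightarrow> separated c (roots ((\<lambda>(q, x). P q x) u))"
    using uniformly_separated_on_compact[OF comp fam sq] by blast
  show ?thesis
  proof (rule that[of c d "r / 2"])
    show "ball p d \<subseteq> L" using d ball_subset_cball by blast
    fix q b assume q: "q \<in> ball p d" and b: "b \<in> ball a (r / 2)" "poly (m q) b = 0"
    have qL: "q \<in> L" "q \<in> cball p d" using q d by auto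
    show "separated c (roots (P q b))"
    proof (rule separated_at_centre[where R = "2 * r" and r = r])
      show "poly_family (ball b (2 * r)) (P q)" using qL(1) by (rule P_family_at)
      show "(\<lambda>x. coeff (P q x) i) holomorphic_on ball b (2 * r)" for i
        using P_holomorphic[OF qL(1)] by (rule holomorphic_on_subset) auto
      fix x assume x: "x \<in> ball b (2 * r)" "x \<noteq> b"
      have "poly (m q) x \<noteq> 0"
      proof
        assume mx: "poly (m q) x = 0"
        have ax: "dist a x < 3 * r" using dist_triangle[of a x b] x b r by simp
        obtain z where z: "z \<in> roots (m p)" "dist x z < r / 2"
          using T(3)[of q] qL d mx unfolding matched_def by blast
        then have "z = a" using near[OF _ z(2) ax] by simp
        then have xa: "dist x a < r / 2" using z by simp
        have "\<exists>!w. w \<in> roots (m q) \<and> dist w a < r / 2"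
          using T(3)[of q] qL d a unfolding matched_def by blast
        moreover have "dist b a < r / 2" using b by (simp add: dist_commute)
        ultimately have "x = b" using mx b(2) xa by blast
        then show False using x by simp
      qed
      then show "rsquarefree (P q x)" using P_simple qL by blast
    next
      fix x assume x: "dist b x = r"
      have "dist a x \<le> 2 * r" "r / 2 \<le> dist a x"
        using dist_triangle[of a x b] dist_triangle[of b x a] x b r by (auto simp: dist_commute)
      then show "separated c (roots (P q x))" using c(2)[of "(q, x)"] qL by simp
    qed (use r c in auto)
  qed (use c d r in auto)
qed

text \<open>This is the absence of splitting: each root over \<open>a\<close> has some root over
  \<open>b\<close> nearby, and uniform separation over \<open>b\<close> allows only one. The second
  conclusion covers noncritical \<open>b\<close> too; it is needed to follow roots over points next
  to the critical value.\<close>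

lemma critical_matched:
  assumes p: "p \<in> L" and a: "poly (m p) a = 0" and e: "0 < e" "separated (2 * e) (roots (P p a))"
  obtains d r where "0 < d" "0 < r" "ball p d \<subseteq> L"
    "\<And>q b. q \<in> ball p d \<Longrightarrow> b \<in> ball a r \<Longrightarrow> poly (m q) b = 0 \<Longrightarrow> matched e (roots (P p a)) (roots (P q b))"
    "\<And>q b y. q \<in> ball p d \<Longrightarrow> b \<in> ball a r \<Longrightarrow> poly (P q b) y = 0 \<Longrightarrow> \<exists>z\<in>roots (P p a). dist y z < e"
proof -
  obtain c d0 r0 where c: "0 < c" "0 < d0" "0 < r0" "ball p d0 \<subseteq> L"
    "\<And>q b. q \<in> ball p d0 \<Longrightarrow> b \<in> ball a r0 \<Longrightarrow> poly (m q) b = 0 \<Longrightarrow> separated c (roots (P q b))"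
    using critical_separated[OF p a] by blast
  \<comment> \<open>Two roots over \<open>b\<close> within \<open>d\<close> of the same root over
    \<open>a\<close> would be less than \<open>c\<close> apart.\<close>
  define d where "d = min e (c / 2)"
  have d: "0 < d" "d \<le> e" "2 * d \<le> c" using e c by (auto simp: d_def)
  have pa: "(p, a) \<in> L \<times> UNIV" using p by simp
  define Q where "Q = (\<lambda>(q, x). P q x)"
  have Q: "Q (q, x) = P q x" for q x by (simp add: Q_def)
  have tends: "poly_tends Q (P p a) (nhds_in (p, a) (L \<times> UNIV))"
    using poly_family_tends[OF P_family pa] by (simp add: Q_def)
  have "\<forall>\<^sub>F u in nhds_in (p, a) (L \<times> UNIV).
      (\<forall>w. poly (Q u) w = 0 \<longrightarrow> (\<exists>z. poly (P p a) z = 0 \<and> dist w z < d)) \<and>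
      (\<forall>z\<in>roots (P p a). \<exists>w. poly (Q u) w = 0 \<and> dist w z < d)"
    using poly_tends_root_near[OF tends _ d(1)] finite_roots_P[OF p]
    by (intro eventually_conj eventually_ball_finite poly_tends_roots_within[OF tends d(1)]) auto
  then obtain T where T: "open T" "(p, a) \<in> T"
    "\<And>u w. u \<in> T \<inter> L \<times> UNIV \<Longrightarrow> poly (Q u) w = 0 \<Longrightarrow> \<exists>z\<in>roots (P p a). dist w z < d"
    "\<And>u z. u \<in> T \<inter> L \<times> UNIV \<Longrightarrow> z \<in> roots (P p a) \<Longrightarrow> \<exists>w\<in>roots (Q u). dist w z < d"
    unfolding eventually_nhds_in mem_Collect_eq Bex_def by blast
  obtain A B where AB: "open A" "open B" "(p, a) \<in> A \<times> B" "A \<times> B \<subseteq> T"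
    using open_prod_elim[OF T(1,2)] by blast
  obtain d1 where d1: "0 < d1" "ball p d1 \<subseteq> A" using AB open_contains_ball by blast
  obtain r1 where r1: "0 < r1" "ball a r1 \<subseteq> B" using AB open_contains_ball by blast
  show ?thesis
  proof (rule that[of "min d0 d1" "min r0 r1"])
    show "ball p (min d0 d1) \<subseteq> L" using c(4) by auto
    fix q b assume qb: "q \<in> ball p (min d0 d1)" "b \<in> ball a (min r0 r1)"
    then have "q \<in> A" "b \<in> B" "q \<in> L" using d1 r1 c(4) by auto
    then have qbT: "(q, b) \<in> T \<inter> L \<times> UNIV" using AB(4) by auto
    show "\<exists>z\<in>roots (P p a). dist y z < e" if "poly (P q b) y = 0" for y
      using T(3)[OF qbT, of y] d(2) that unfolding Q by fastforce
    assume b: "poly (m q) b = 0"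
    have "separated (2 * d) (roots (P q b))" using c(5)[OF _ _ b] qb d(3) by (auto intro: separated_mono)
    then have "matched d (roots (P p a)) (roots (P q b))"
      using T(3,4)[OF qbT] unfolding Q by (intro matched_of_separated) auto
    then show "matched e (roots (P p a)) (roots (P q b))" using e(2) d(2) by (rule matched_mono)
  qed (use c d1 r1 in auto)
qed

end

section \<open>Matching ordered fibres by a plane homeomorphism\<close>

text \<open>The identity plus an offset, with nodes \<open>a 0\<close> to \<open>a n\<close>.
  Between consecutive nodes the clamped ramp changes the offset linearly from
  \<open>b n - a n\<close> to its next value. In this form joint continuity in nodes, values and
  argument follows from the limit rules for \<open>max\<close> and \<open>min\<close>.\<close>

primrec pl :: "(nat \<Rightarrow> real) \<Rightarrow> (nat \<Rightarrow> real) \<Rightarrow> nat \<Rightarrow> real \<Rightarrow> real" where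
  "pl a b 0 v = v + (b 0 - a 0)"
| "pl a b (Suc n) v = pl a b n v +
    ((b (Suc n) - a (Suc n)) - (b n - a n)) * max 0 (min 1 ((v - a n) / (a (Suc n) - a n)))"

text \<open>The piecewise linear map with slope 1 outside the nodes taking the node \<open>a k\<close> to \<open>b k\<close>
  for \<open>k < n\<close>.\<close>

definition interpolate :: "(nat \<Rightarrow> real) \<Rightarrow> (nat \<Rightarrow> real) \<Rightarrow> nat \<Rightarrow> real \<Rightarrow> real" where
  "interpolate a b n v = (if n = 0 then v else pl a b (n - 1) v)"

text \<open>The four claims are proved together, since the induction step needs to know that the map
  is a translation beyond its last node. The last claim holds because the offset between two nodes
  is a convex combination of theirs.\<close>

lemma pl_props:
  assumes "\<And>k. k < n \<Longrightarrow> a k < a (Suc k)" "\<And>k. k < n \<Longrightarrow> b k < b (Suc k)"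
  shows "strict_mono (pl a b n)" "\<And>v. a n \<le> v \<Longrightarrow> pl a b n v = v + (b n - a n)"
    "\<And>k. k \<le> n \<Longrightarrow> pl a b n (a k) = b k"
    "\<And>v M. (\<And>k. k \<le> n \<Longrightarrow> \<bar>b k - a k\<bar> \<le> M) \<Longrightarrow> \<bar>pl a b n v - v\<bar> \<le> M"
proof -
  have "strict_mono (pl a b n) \<and> (\<forall>v. a n \<le> v \<longrightarrow> pl a b n v = v + (b n - a n)) \<and>
    (\<forall>k\<le>n. pl a b n (a k) = b k) \<and> (\<forall>M. (\<forall>k\<le>n. \<bar>b k - a k\<bar> \<le> M) \<longrightarrow> (\<forall>v. \<bar>pl a b n v - v\<bar> \<le> M))"
    using assms
  proof (induction n)
    case 0
    show ?case by (auto simp: strict_mono_def)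
  next
    case (Suc n)
    let ?f = "pl a b n"
    define g where "g = pl a b (Suc n)"
    have g: "g v = ?f v + ((b (Suc n) - a (Suc n)) - (b n - a n)) * max 0 (min 1 ((v - a n) / (a (Suc n) - a n)))" for v
      by (simp add: g_def)
    have IH: "strict_mono ?f" "\<And>v. a n \<le> v \<Longrightarrow> ?f v = v + (b n - a n)" "\<And>k. k \<le> n \<Longrightarrow> ?f (a k) = b k"
      "\<And>M v. (\<And>k. k \<le> n \<Longrightarrow> \<bar>b k - a k\<bar> \<le> M) \<Longrightarrow> \<bar>?f v - v\<bar> \<le> M"
      using Suc by auto
    have ab: "a n < a (Suc n)" "b n < b (Suc n)" using Suc.prems by auto
    define t where "t v = (v - a n) / (a (Suc n) - a n)" for v
    have g1: "g v = ?f v" if "v \<le> a n" for v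
    proof -
      have "max 0 (min 1 ((v - a n) / (a (Suc n) - a n))) = 0"
        using that ab by (intro max_absorb1 min.coboundedI2 divide_nonpos_pos) auto
      then show ?thesis by (simp add: g)
    qed
    have g2: "g v = v + ((1 - t v) * (b n - a n) + t v * (b (Suc n) - a (Suc n)))" "0 \<le> t v" "t v \<le> 1"
      if "a n \<le> v" "v \<le> a (Suc n)" for v
    proof -
      show t: "0 \<le> t v" "t v \<le> 1" using that ab by (auto simp: t_def)
      have "max 0 (min 1 (t v)) = t v" using t by auto
      then show "g v = v + ((1 - t v) * (b n - a n) + t v * (b (Suc n) - a (Suc n)))"
        using IH(2)[OF that(1)] by (simp add: g t_def[symmetric] algebra_simps)
    qed
    have g2': "g v = b n + t v * (b (Suc n) - b n)" if "a n \<le> v" "v \<le> a (Suc n)" for v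
    proof -
      have "t v * (a (Suc n) - a n) = v - a n" using ab by (simp add: t_def)
      then show ?thesis using g2(1)[OF that] by (simp add: algebra_simps)
    qed
    have g3: "g v = v + (b (Suc n) - a (Suc n))" if "a (Suc n) \<le> v" for v
    proof -
      have "1 \<le> (v - a n) / (a (Suc n) - a n)" using that ab by simp
      then have "max 0 (min 1 ((v - a n) / (a (Suc n) - a n))) = 1" by simp
      then show ?thesis using IH(2)[of v] that ab by (simp add: g)
    qed
    have m1: "g u < g v" if "u < v" "v \<le> a n" for u v
      using that g1 IH(1) by (simp add: strict_monoD)
    have m2: "g u < g v" if "u < v" "a n \<le> u" "v \<le> a (Suc n)" for u v
    proof -
      have "t u < t v" using that ab by (simp add: t_def divide_strict_right_mono)
      then show ?thesis using that g2'[of u] g2'[of v] ab by simp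
    qed
    have m3: "g u < g v" if "u < v" "a (Suc n) \<le> u" for u v
      using that g3[of u] g3[of v] by simp
    have m23: "g u < g v" if "u < v" "a n \<le> u" for u v
      using that m2[of u v] m3[of u v] m2[of u "a (Suc n)"] m3[of "a (Suc n)" v]
      by (meson less_trans not_le order_refl)
    have "strict_mono g"
    proof (rule strict_monoI)
      fix u v :: real assume "u < v"
      then show "g u < g v"
        using m1[of u v] m23[of u v] m1[of u "a n"] m23[of "a n" v]
        by (meson less_trans not_le order_refl)
    qed
    moreover have "g (a k) = b k" if "k \<le> Suc n" for k
    proof (cases "k = Suc n")
      case False
      then have k: "k \<le> n" using that by simp
      have "a k \<le> a n" using k Suc.prems(1)
      proof (induction rule: dec_induct)
        case (step j)
        then show ?case using less_imp_le[OF step.prems[of j]] by simp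
      qed simp
      then show ?thesis using g1 IH(3)[OF k] by simp
    qed (use g3[of "a (Suc n)"] in simp)
    moreover have "\<bar>g v - v\<bar> \<le> M" if M: "\<And>k. k \<le> Suc n \<Longrightarrow> \<bar>b k - a k\<bar> \<le> M" for v M
    proof -
      consider "v \<le> a n" | "a n \<le> v" "v \<le> a (Suc n)" | "a (Suc n) \<le> v" by linarith
      then show ?thesis
      proof cases
        case 1
        then show ?thesis using g1[OF 1] IH(4)[of M v] M by simp
      next
        case 2
        have "\<bar>g v - v\<bar> \<le> \<bar>(1 - t v) * (b n - a n)\<bar> + \<bar>t v * (b (Suc n) - a (Suc n))\<bar>"
          unfolding g2(1)[OF 2] by simp
        also have "\<dots> \<le> (1 - t v) * M + t v * M"
          unfolding abs_mult using g2(2,3)[OF 2] M[of n] M[of "Suc n"]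
          by (intro add_mono mult_mono) auto
        finally show ?thesis by (simp add: algebra_simps)
      next
        case 3
        then show ?thesis using g3[OF 3] M[of "Suc n"] by simp
      qed
    qed
    ultimately show ?case using g3 unfolding g_def by blast
  qed
  then show "strict_mono (pl a b n)" "\<And>v. a n \<le> v \<Longrightarrow> pl a b n v = v + (b n - a n)"
    "\<And>k. k \<le> n \<Longrightarrow> pl a b n (a k) = b k"
    "\<And>v M. (\<And>k. k \<le> n \<Longrightarrow> \<bar>b k - a k\<bar> \<le> M) \<Longrightarrow> \<bar>pl a b n v - v\<bar> \<le> M"
    by auto
qed

lemma interpolate_props:
  assumes a: "\<And>j k. j < k \<Longrightarrow> k < n \<Longrightarrow> a j < a k" and b: "\<And>j k. j < k \<Longrightarrow> k < n \<Longrightarrow> b j < b k"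
  shows "strict_mono (interpolate a b n)"
    "\<And>k. k < n \<Longrightarrow> interpolate a b n (a k) = b k"
    "\<And>v M. 0 \<le> M \<Longrightarrow> (\<And>k. k < n \<Longrightarrow> \<bar>b k - a k\<bar> \<le> M) \<Longrightarrow> \<bar>interpolate a b n v - v\<bar> \<le> M"
proof -
  have ab: "a k < a (Suc k)" "b k < b (Suc k)" if "k < n - 1" for k using that assms by auto
  show "strict_mono (interpolate a b n)"
    using pl_props(1)[of "n - 1" a b] ab by (cases "n = 0") (auto simp: interpolate_def strict_mono_def)
  show "interpolate a b n (a k) = b k" if "k < n" for k
    using pl_props(3)[of "n - 1" a b k] ab that by (simp add: interpolate_def)
  show "\<bar>interpolate a b n v - v\<bar> \<le> M" if "0 \<le> M" "\<And>k. k < n \<Longrightarrow> \<bar>b k - a k\<bar> \<le> M" for v M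
    using pl_props(4)[of "n - 1" a b M v] ab that by (simp add: interpolate_def)
qed

lemma tendsto_pl:
  assumes "\<And>k. k < n \<Longrightarrow> a k \<noteq> a (Suc k)"
    and "\<And>k. k \<le> n \<Longrightarrow> ((\<lambda>u. A u k) \<longlongrightarrow> a k) U" "\<And>k. k \<le> n \<Longrightarrow> ((\<lambda>u. B u k) \<longlongrightarrow> b k) U"
    and "(V \<longlongrightarrow> v) U"
  shows "((\<lambda>u. pl (A u) (B u) n (V u)) \<longlongrightarrow> pl a b n v) U"
  using assms(1-3)
proof (induction n)
  case 0
  then show ?case using assms(4) by (auto intro!: tendsto_intros)
next
  case (Suc n)
  have "a (Suc n) - a n \<noteq> 0" using Suc.prems(1)[of n] by simp
  then show ?case using Suc assms(4)
    by (auto intro!: tendsto_add tendsto_mult tendsto_max tendsto_min tendsto_diff tendsto_divide tendsto_const)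
qed

lemma tendsto_interpolate:
  assumes a: "\<And>j k. j < k \<Longrightarrow> k < n \<Longrightarrow> a j < a k"
    and "\<And>k. k < n \<Longrightarrow> ((\<lambda>u. A u k) \<longlongrightarrow> a k) U" "\<And>k. k < n \<Longrightarrow> ((\<lambda>u. B u k) \<longlongrightarrow> b k) U"
    and V: "(V \<longlongrightarrow> v) U"
  shows "((\<lambda>u. interpolate (A u) (B u) n (V u)) \<longlongrightarrow> interpolate a b n v) U"
proof (cases "n = 0")
  case False
  have "((\<lambda>u. pl (A u) (B u) (n - 1) (V u)) \<longlongrightarrow> pl a b (n - 1) v) U"
  proof (rule tendsto_pl[OF _ _ _ V])
    show "a k \<noteq> a (Suc k)" if "k < n - 1" for k using a[of k "Suc k"] that by (metis Suc_lessI less_diff_conv less_irrefl Suc_eq_plus1 lessI)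
  qed (use assms(2,3) False in auto)
  then show ?thesis using False by (simp add: interpolate_def)
qed (use V in \<open>simp add: interpolate_def\<close>)

lemma continuous_on_interpolate:
  assumes a: "\<And>j k. j < k \<Longrightarrow> k < n \<Longrightarrow> a j < a k" and V: "continuous_on S V"
  shows "continuous_on S (\<lambda>x. interpolate a b n (V x))"
  using V unfolding continuous_on_def
  by (auto intro!: tendsto_interpolate[OF a])

lemma surj_near_identity:
  fixes g :: "real \<Rightarrow> real"
  assumes "continuous_on UNIV g" "\<And>v. \<bar>g v - v\<bar> \<le> M"
  shows "surj g"
proof -
  have "\<exists>v. g v = y" for y
  proof -
    have "g (y - M) \<le> y" "y \<le> g (y + M)" "y - M \<le> y + M"
      using assms(2)[of "y - M"] assms(2)[of "y + M"] by auto
    moreover have "continuous_on {y - M..y + M} g" using assms(1) by (rule continuous_on_subset) simp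
    ultimately show ?thesis using IVT'[of g "y - M" y "y + M"] by blast
  qed
  then show ?thesis by (metis surjI)
qed

lemma nth_elem_less: "j < k \<Longrightarrow> k < card S \<Longrightarrow> nth_elem S j < nth_elem S k"
  using sorted_wrt_nth_less[OF strict_sorted_list_of_set[of S]] by simp

lemma nth_elem_image: "finite S \<Longrightarrow> nth_elem S ` {..<card S} = S"
proof -
  assume S: "finite S"
  have "nth_elem S ` {..<card S} = set (sorted_list_of_set S)" by (auto simp: set_conv_nth)
  then show ?thesis using S by simp
qed

text \<open>\<open>S\<close> and \<open>T\<close> are the fibres of two curves over a common line
  and \<open>A\<close> holds the critical values. Fibres over \<open>A\<close> may have fewer points
  than their neighbours; the point of \<open>cluster\<close> is that the same \<open>j\<close>
  serves both curves, so that equal ranks merge equally.\<close>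

locale fibrewise_match =
  fixes A :: "real set" and S T :: "real \<Rightarrow> real set"
  assumes finite_A: "finite A"
    and finite_S: "finite (S x)" and finite_T: "finite (T x)"
    and card_eq: "card (S x) = card (T x)"
    and card_loc: "x \<notin> A \<Longrightarrow> \<forall>\<^sub>F y in nhds x. card (S y) = card (S x)"
    and S_cont: "x \<notin> A \<Longrightarrow> k < card (S x) \<Longrightarrow> ((\<lambda>y. nth_elem (S y) k) \<longlongrightarrow> nth_elem (S x) k) (nhds x)"
    and T_cont: "x \<notin> A \<Longrightarrow> k < card (S x) \<Longrightarrow> ((\<lambda>y. nth_elem (T y) k) \<longlongrightarrow> nth_elem (T x) k) (nhds x)"
    and cluster: "a \<in> A \<Longrightarrow> 0 < e \<Longrightarrow> \<forall>\<^sub>F x in at a. \<forall>k<card (S x). \<exists>j<card (S a).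
        \<bar>nth_elem (S x) k - nth_elem (S a) j\<bar> < e \<and> \<bar>nth_elem (T x) k - nth_elem (T a) j\<bar> < e"
begin

definition gap :: real where
  "gap = (SOME w. 0 < w \<and> separated (2 * w) A)"

lemma gap: "0 < gap" "separated (2 * gap) A"
proof -
  have fin: "finite (complex_of_real ` A)" using finite_A by simp
  obtain e where e: "0 < e" "separated e (complex_of_real ` A)"
    by (rule ex_separated[OF fin], rule that)
  have "real_part (complex_of_real ` A) = A" by auto
  then have "separated (2 * (e / 2)) A" using separated_real_part[OF e(2)] by simp
  then have "\<exists>w. 0 < w \<and> separated (2 * w) A" using e by (intro exI[of _ "e / 2"]) auto
  then show "0 < gap" "separated (2 * gap) A" unfolding gap_def by (metis (mono_tags, lifting) someI_ex)+
qed

text \<open>A bump of height 1 at \<open>a\<close> and radius \<open>gap\<close>. As distinct points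
  of \<open>A\<close> are at least \<open>2 * gap\<close> apart, at most one bump is nonzero at any
  \<open>x\<close>.\<close>

definition tent :: "real \<Rightarrow> real \<Rightarrow> real" where
  "tent a x = max 0 (1 - \<bar>x - a\<bar> / gap)"

lemma tent_bounds: "0 \<le> tent a x" "tent a x \<le> 1"
  using gap by (auto simp: tent_def)

lemma tent_unique: "a \<in> A \<Longrightarrow> b \<in> A \<Longrightarrow> tent a x \<noteq> 0 \<Longrightarrow> tent b x \<noteq> 0 \<Longrightarrow> a = b"
proof (rule ccontr)
  assume ab: "a \<in> A" "b \<in> A" "tent a x \<noteq> 0" "tent b x \<noteq> 0" "a \<noteq> b"
  have "\<bar>x - c\<bar> < gap" if "tent c x \<noteq> 0" for c
  proof -
    have "0 < 1 - \<bar>x - c\<bar> / gap" using that unfolding tent_def by linarith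
    then show ?thesis using gap(1) by (simp add: field_simps)
  qed
  then have "\<bar>x - a\<bar> < gap" "\<bar>x - b\<bar> < gap" using ab by blast+
  moreover have "2 * gap \<le> \<bar>a - b\<bar>" using gap(2) ab unfolding separated_def dist_real_def by blast
  ultimately show False by linarith
qed

definition h :: "real \<Rightarrow> real \<Rightarrow> real" where
  "h a = interpolate (nth_elem (S a)) (nth_elem (T a)) (card (S a))"

lemma h: "strict_mono (h a)" "k < card (S a) \<Longrightarrow> h a (nth_elem (S a) k) = nth_elem (T a) k"
    "continuous_on UNIV (h a)" "\<exists>M. \<forall>v. \<bar>h a v - v\<bar> \<le> M"
proof -
  have lt: "j < k \<Longrightarrow> k < card (S a) \<Longrightarrow> nth_elem (S a) j < nth_elem (S a) k"
    "j < k \<Longrightarrow> k < card (S a) \<Longrightarrow> nth_elem (T a) j < nth_elem (T a) k" for j k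
    using nth_elem_less[of j k "S a"] nth_elem_less[of j k "T a"] card_eq[of a] by auto
  show "strict_mono (h a)" unfolding h_def by (rule interpolate_props(1)[OF lt])
  show "k < card (S a) \<Longrightarrow> h a (nth_elem (S a) k) = nth_elem (T a) k"
    unfolding h_def by (rule interpolate_props(2)[OF lt])
  show "continuous_on UNIV (h a)"
    unfolding h_def by (rule continuous_on_interpolate[OF lt(1), of _ _ UNIV "\<lambda>v. v"]) (auto intro: continuous_on_id)
  let ?M = "\<Sum>k<card (S a). \<bar>nth_elem (T a) k - nth_elem (S a) k\<bar>"
  have "\<bar>h a v - v\<bar> \<le> ?M" for v unfolding h_def
    by (rule interpolate_props(3)[OF lt]) (auto intro!: sum_nonneg member_le_sum)
  then show "\<exists>M. \<forall>v. \<bar>h a v - v\<bar> \<le> M" by blast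
qed

text \<open>\<open>H x\<close> deforms \<open>h a\<close> at \<open>x = a\<close> to the identity away from \<open>A\<close>. It carries the
  points where the roots over \<open>x\<close> cluster, as \<open>x \<rightarrow> a\<close>, to the corresponding points for \<open>T\<close>, so
  that the remaining interpolation \<open>psi\<close> tends to the identity.\<close>

definition H :: "real \<Rightarrow> real \<Rightarrow> real" where
  "H x y = y + (\<Sum>a\<in>A. tent a x * (h a y - y))"

text \<open>With at most one tent active, \<open>H x\<close> is a convex combination of the identity
  and a single \<open>h a\<close>, which makes it strictly increasing.\<close>

lemma H_cases: "(\<exists>a\<in>A. \<exists>t. 0 \<le> t \<and> t \<le> 1 \<and> H x = (\<lambda>y. (1 - t) * y + t * h a y)) \<or> H x = (\<lambda>y. y)"
proof (cases "\<exists>a\<in>A. tent a x \<noteq> 0")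
  case True
  then obtain a where a: "a \<in> A" "tent a x \<noteq> 0" by blast
  have "(\<Sum>b\<in>A. tent b x * (h b y - y)) = (\<Sum>b\<in>{a}. tent b x * (h b y - y))" for y
    using finite_A a by (intro sum.mono_neutral_right) (auto dest: tent_unique[OF a(1) _ a(2)])
  then have "H x = (\<lambda>y. (1 - tent a x) * y + tent a x * h a y)"
    by (simp add: H_def fun_eq_iff algebra_simps)
  then show ?thesis using a(1) tent_bounds by blast
qed (simp add: H_def fun_eq_iff)

lemma H_at: "a \<in> A \<Longrightarrow> H a = h a"
proof -
  assume a: "a \<in> A"
  have 1: "tent a a = 1" by (simp add: tent_def)
  have "(\<Sum>b\<in>A. tent b a * (h b y - y)) = (\<Sum>b\<in>{a}. tent b a * (h b y - y))" for y
  proof (intro sum.mono_neutral_right ballI)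
    fix b assume "b \<in> A - {a}"
    then have "tent b a = 0" using tent_unique[OF a, of b a] 1 by force
    then show "tent b a * (h b y - y) = 0" by simp
  qed (use finite_A a in auto)
  then show ?thesis using 1 by (simp add: H_def fun_eq_iff)
qed

lemma H_strict_mono: "strict_mono (H x)"
proof -
  have "strict_mono (\<lambda>y. (1 - t) * y + t * h a y)" if t: "0 \<le> t" "t \<le> 1" for a t
  proof (rule strict_monoI)
    fix y z :: real assume yz: "y < z"
    show "(1 - t) * y + t * h a y < (1 - t) * z + t * h a z"
    proof (cases "t = 0")
      case False
      then have "t * h a y < t * h a z" using t strict_monoD[OF h(1) yz] by simp
      moreover have "(1 - t) * y \<le> (1 - t) * z" using t yz by (simp add: mult_left_mono)
      ultimately show ?thesis by simp
    qed (use yz in simp)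
  qed
  then show ?thesis using H_cases[of x] by (auto simp: strict_mono_def)
qed

lemma H_continuous: "continuous_on UNIV (\<lambda>(x, y). H x y)"
proof -
  have "continuous_on UNIV (\<lambda>u::real \<times> real. h a (snd u))" for a
    by (rule continuous_on_compose2[OF h(3)]) (auto intro: continuous_intros)
  then show ?thesis unfolding H_def tent_def case_prod_beta
    using gap(1) by (intro continuous_intros) auto
qed

lemma H_near_identity: "\<exists>M. \<forall>y. \<bar>H x y - y\<bar> \<le> M"
proof -
  obtain M where M: "\<And>a v. \<bar>h a v - v\<bar> \<le> M a" using h(4) by metis
  have "\<bar>H x y - y\<bar> \<le> (\<Sum>a\<in>A. M a)" for y
  proof -
    have "\<bar>H x y - y\<bar> \<le> (\<Sum>a\<in>A. \<bar>tent a x * (h a y - y)\<bar>)" unfolding H_def by simp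
    also have "\<dots> \<le> (\<Sum>a\<in>A. 1 * M a)" unfolding abs_mult
      by (intro sum_mono mult_mono) (use tent_bounds M in \<open>auto simp: abs_of_nonneg\<close>)
    finally show ?thesis by simp
  qed
  then show ?thesis by blast
qed

text \<open>Direct interpolation from \<open>S x\<close> to \<open>T x\<close> is not controlled as
  \<open>x\<close> approaches \<open>A\<close>, where nodes collide and slopes may degenerate. After
  \<open>H x\<close> the nodes are already almost in place, and the correction is no larger than the
  greatest remaining displacement of a node.\<close>

definition psi :: "real \<Rightarrow> real \<Rightarrow> real" where
  "psi x y = (if x \<in> A then H x y else
     interpolate (\<lambda>k. H x (nth_elem (S x) k)) (nth_elem (T x)) (card (S x)) (H x y))"

lemma nodes_less:
  "j < k \<Longrightarrow> k < card (S x) \<Longrightarrow> H x (nth_elem (S x) j) < H x (nth_elem (S x) k)"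
  "j < k \<Longrightarrow> k < card (S x) \<Longrightarrow> nth_elem (T x) j < nth_elem (T x) k"
  using nth_elem_less[of j k "S x"] nth_elem_less[of j k "T x"] card_eq[of x] strict_monoD[OF H_strict_mono]
  by auto

lemma psi_strict_mono: "strict_mono (psi x)"
  using H_strict_mono[of x] interpolate_props(1)[OF nodes_less[of _ _ x]]
  by (auto simp: psi_def strict_mono_def)

lemma psi_nth: "k < card (S x) \<Longrightarrow> psi x (nth_elem (S x) k) = nth_elem (T x) k"
proof -
  assume k: "k < card (S x)"
  have "interpolate (\<lambda>k. H x (nth_elem (S x) k)) (nth_elem (T x)) (card (S x)) (H x (nth_elem (S x) k)) = nth_elem (T x) k"
    using nodes_less k by (rule interpolate_props(2))
  then show ?thesis using h(2)[OF k] by (simp add: psi_def H_at)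
qed

lemma psi_image: "psi x ` S x = T x"
proof -
  have "psi x ` S x = psi x ` nth_elem (S x) ` {..<card (S x)}" using nth_elem_image[OF finite_S] by simp
  also have "\<dots> = nth_elem (T x) ` {..<card (T x)}" using psi_nth card_eq[of x] by (auto simp: image_image)
  also have "\<dots> = T x" by (rule nth_elem_image[OF finite_T])
  finally show ?thesis .
qed

lemma psi_near_H:
  assumes "0 \<le> M" "\<And>k. k < card (S x) \<Longrightarrow> \<bar>nth_elem (T x) k - H x (nth_elem (S x) k)\<bar> \<le> M"
  shows "\<bar>psi x y - H x y\<bar> \<le> M"
  using interpolate_props(3)[OF nodes_less[of _ _ x] assms] assms(1) by (simp add: psi_def)

lemma tendsto_H: "((\<lambda>u. H (f u) (g u)) \<longlongrightarrow> H x y) U"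
  if "(f \<longlongrightarrow> x) U" "(g \<longlongrightarrow> y) U"
proof -
  have "isCont (\<lambda>(x, y). H x y) (x, y)"
    using H_continuous by (simp add: continuous_on_eq_continuous_at)
  from isCont_tendsto_compose[OF this tendsto_Pair[OF that]] show ?thesis by simp
qed

text \<open>Away from \<open>A\<close> the nodes stay distinct and the interpolation is continuous
  in all its data. At a point of \<open>A\<close> the difference between \<open>psi x\<close> and
  \<open>H x\<close> tends to 0 uniformly in \<open>y\<close>, and \<open>H\<close> is
  continuous.\<close>

lemma psi_tendsto: "((\<lambda>(x, y). psi x y) \<longlongrightarrow> psi x0 y0) (nhds (x0, y0))"
proof -
  let ?N = "nhds (x0, y0)"
  have fst: "filterlim fst (nhds x0) ?N" and snd: "filterlim snd (nhds y0) ?N"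
    by (rule tendsto_fst[of "\<lambda>u. u" "(x0, y0)", simplified] tendsto_snd[of "\<lambda>u. u" "(x0, y0)", simplified], rule filterlim_ident)+
  have Hl: "((\<lambda>u. H (fst u) (snd u)) \<longlongrightarrow> H x0 y0) ?N" by (rule tendsto_H[OF fst snd])
  show ?thesis
  proof (cases "x0 \<in> A")
    case False
    let ?n = "card (S x0)"
    let ?g = "\<lambda>u. interpolate (\<lambda>k. H (fst u) (nth_elem (S (fst u)) k)) (nth_elem (T (fst u))) ?n (H (fst u) (snd u))"
    have "(?g \<longlongrightarrow> interpolate (\<lambda>k. H x0 (nth_elem (S x0) k)) (nth_elem (T x0)) ?n (H x0 y0)) ?N"
      by (intro tendsto_interpolate nodes_less tendsto_H fst Hl
          filterlim_compose[OF S_cont[OF False] fst] filterlim_compose[OF T_cont[OF False] fst])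
    moreover have "\<forall>\<^sub>F u in ?N. ?g u = (\<lambda>(x, y). psi x y) u"
    proof -
      have "\<forall>\<^sub>F x in nhds x0. x \<in> - A"
        using False finite_A by (intro eventually_nhds_in_open) (auto simp: finite_imp_closed open_Compl)
      then have "\<forall>\<^sub>F u in ?N. fst u \<in> - A" using fst by (rule eventually_compose_filterlim)
      moreover have "\<forall>\<^sub>F u in ?N. card (S (fst u)) = ?n"
        using card_loc[OF False] fst by (rule eventually_compose_filterlim)
      ultimately show ?thesis by eventually_elim (auto simp: psi_def)
    qed
    ultimately show ?thesis using False by (simp add: psi_def) (rule Lim_transform_eventually)
  next
    case True
    have "((\<lambda>u. psi (fst u) (snd u) - H (fst u) (snd u)) \<longlongrightarrow> 0) ?N"
    proof (rule tendstoI)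
      fix e :: real assume e: "0 < e"
      \<comment> \<open>Continuity of \<open>H\<close> at the finitely many points of the fibre over
        \<open>x0\<close>: nodes clustering at the \<open>j\<close>-th point are sent close to the
        \<open>j\<close>-th point of \<open>T x0\<close>, where the nodes of \<open>T x\<close>
        cluster as well.\<close>
      have "\<exists>d>0. \<forall>x y. \<bar>x - x0\<bar> < d \<longrightarrow> \<bar>y - nth_elem (S x0) j\<bar> < d \<longrightarrow> \<bar>H x y - nth_elem (T x0) j\<bar> < e / 4"
        if j: "j < card (S x0)" for j
      proof -
        let ?z = "nth_elem (S x0) j"
        have "isCont (\<lambda>(x, y). H x y) (x0, ?z)"
          using H_continuous by (simp add: continuous_on_eq_continuous_at)
        then obtain d where d: "0 < d" "\<And>u. dist u (x0, ?z) < d \<Longrightarrow> dist ((\<lambda>(x, y). H x y) u) (H x0 ?z) < e / 4"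
          using e unfolding continuous_at_eps_delta by (metis case_prod_conv divide_pos_pos zero_less_numeral)
        have Hz: "H x0 ?z = nth_elem (T x0) j" using H_at[OF True] h(2)[OF j] by simp
        have "\<bar>H x y - nth_elem (T x0) j\<bar> < e / 4" if "\<bar>x - x0\<bar> < d / 2" "\<bar>y - ?z\<bar> < d / 2" for x y
        proof -
          have "dist (x, y) (x0, ?z) \<le> \<bar>x - x0\<bar> + \<bar>y - ?z\<bar>"
            unfolding dist_Pair_Pair dist_real_def by (rule order_trans[OF sqrt_sum_squares_le_sum_abs]) simp
          then have "dist (x, y) (x0, ?z) < d" using that by simp
          from d(2)[OF this] show ?thesis by (simp add: Hz dist_real_def)
        qed
        then show ?thesis using d(1) by (intro exI[of _ "d / 2"]) auto
      qed
      then obtain D where D: "\<And>j. j < card (S x0) \<Longrightarrow> 0 < D j"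
        "\<And>j x y. j < card (S x0) \<Longrightarrow> \<bar>x - x0\<bar> < D j \<Longrightarrow> \<bar>y - nth_elem (S x0) j\<bar> < D j \<Longrightarrow> \<bar>H x y - nth_elem (T x0) j\<bar> < e / 4"
        by metis
      define d where "d = Min (insert 1 (D ` {..<card (S x0)}))"
      have "0 < d" "\<And>j. j < card (S x0) \<Longrightarrow> d \<le> D j" unfolding d_def using D(1) by auto
      then have d: "0 < d" "\<And>j x y. j < card (S x0) \<Longrightarrow> \<bar>x - x0\<bar> < d \<Longrightarrow> \<bar>y - nth_elem (S x0) j\<bar> < d \<Longrightarrow>
          \<bar>H x y - nth_elem (T x0) j\<bar> < e / 4" using D(2) by (blast intro: less_le_trans)+
      have "\<forall>\<^sub>F x in at x0. \<forall>k<card (S x). \<exists>j<card (S x0). \<bar>nth_elem (S x) k - nth_elem (S x0) j\<bar> < min d (e / 4) \<and>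
            \<bar>nth_elem (T x) k - nth_elem (T x0) j\<bar> < min d (e / 4)"
        using d e by (intro cluster True) auto
      moreover have "\<forall>\<^sub>F x in at x0. \<bar>x - x0\<bar> < d" using d(1) by (auto simp: eventually_at dist_real_def)
      ultimately have "\<forall>\<^sub>F x in at x0. \<forall>y. \<bar>psi x y - H x y\<bar> \<le> e / 2"
      proof eventually_elim
        case (elim x)
        show ?case
        proof (intro allI psi_near_H)
          fix k assume "k < card (S x)"
          then obtain j where j: "j < card (S x0)" "\<bar>nth_elem (S x) k - nth_elem (S x0) j\<bar> < d"
              "\<bar>nth_elem (T x) k - nth_elem (T x0) j\<bar> < e / 4" using elim(1) by auto
          then show "\<bar>nth_elem (T x) k - H x (nth_elem (S x) k)\<bar> \<le> e / 2"
            using d(2)[OF j(1) elim(2) j(2)] by linarith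
        qed (use e in simp)
      qed
      \<comment> \<open>At \<open>x0\<close> itself \<open>psi\<close> and \<open>H\<close> coincide
        by definition, so the punctured neighbourhood can be filled in.\<close>
      then have "\<forall>\<^sub>F x in nhds x0. \<forall>y. \<bar>psi x y - H x y\<bar> \<le> e / 2"
        using True e by (simp add: eventually_nhds_conv_at psi_def)
      then have "\<forall>\<^sub>F u in ?N. \<forall>y. \<bar>psi (fst u) y - H (fst u) y\<bar> \<le> e / 2"
        using fst by (rule eventually_compose_filterlim)
      then show "\<forall>\<^sub>F u in ?N. dist (psi (fst u) (snd u) - H (fst u) (snd u)) 0 < e"
      proof eventually_elim
        case (elim u)
        then have "\<bar>psi (fst u) (snd u) - H (fst u) (snd u)\<bar> \<le> e / 2" by blast
        then show ?case using e by (simp add: dist_real_def)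
      qed
    qed
    from tendsto_add[OF this Hl] show ?thesis using True H_at[OF True] by (simp add: psi_def[of x0] case_prod_beta')
  qed
qed

lemma psi_continuous: "continuous_on UNIV (\<lambda>(x, y). psi x y)"
proof -
  have "isCont (\<lambda>(x, y). psi x y) u" for u
    using psi_tendsto[of "fst u" "snd u"] tendsto_at_iff_tendsto_nhds[of "\<lambda>(x, y). psi x y" u]
    by (simp add: isCont_def case_prod_beta)
  then show ?thesis by (simp add: continuous_at_imp_continuous_on)
qed

lemma psi_surj: "surj (psi x)"
proof -
  obtain M where M: "\<And>y. \<bar>H x y - y\<bar> \<le> M" using H_near_identity by blast
  let ?M = "\<Sum>k<card (S x). \<bar>nth_elem (T x) k - H x (nth_elem (S x) k)\<bar>"
  have "\<bar>psi x y - H x y\<bar> \<le> ?M" for y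
    by (rule psi_near_H) (auto intro!: sum_nonneg member_le_sum)
  then have "\<bar>psi x y - y\<bar> \<le> ?M + M" for y using M[of y] by (smt (verit))
  moreover have "continuous_on UNIV (psi x)"
  proof -
    have "continuous_on UNIV (\<lambda>y::real. (x, y))" by (intro continuous_intros)
    from continuous_on_compose2[OF psi_continuous this] show ?thesis by simp
  qed
  ultimately show ?thesis using surj_near_identity by blast
qed

text \<open>Continuity of the inverse comes from invariance of domain; it remains to see that the
  map is a continuous bijection, which holds line by line.\<close>

lemma homeomorphism_of_plane:
  fixes phi :: "real \<Rightarrow> real"
  assumes phi: "continuous_on UNIV phi" "inj phi" "surj phi"
  obtains f g where "homeomorphism UNIV UNIV f g"
    "f ` {(x, y). y \<in> S x} = {(x', y). \<exists>x. x' = phi x \<and> y \<in> T x}"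
proof -
  define f :: "real \<times> real \<Rightarrow> real \<times> real" where "f u = (phi (fst u), psi (fst u) (snd u))" for u
  have "continuous_on UNIV f" unfolding f_def
    using psi_continuous by (intro continuous_on_Pair continuous_on_compose2[OF phi(1)])
      (auto simp: case_prod_beta intro: continuous_intros)
  moreover have inj: "inj f"
  proof (rule injI)
    fix u v assume "f u = f v"
    then have "fst u = fst v" "psi (fst u) (snd u) = psi (fst v) (snd v)"
      using phi(2) by (auto simp: f_def inj_eq)
    then show "u = v"
      using inj_eq[OF strict_mono_imp_inj_on[OF psi_strict_mono[of "fst v"]]] by (simp add: prod_eq_iff)
  qed
  ultimately obtain g where "homeomorphism UNIV (f ` UNIV) f g"
    using invariance_of_domain_homeomorphism[of UNIV f] by auto
  moreover have "surj f"
  proof -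
    have "\<exists>u. f u = (x', y')" for x' y'
    proof -
      obtain x where x: "phi x = x'" using phi(3) by (metis surjD)
      obtain y where "psi x y = y'" using psi_surj by (metis surjD)
      then show ?thesis using x by (intro exI[of _ "(x, y)"]) (simp add: f_def)
    qed
    then show ?thesis by (metis surj_def surj_pair)
  qed
  moreover have "f ` {(x, y). y \<in> S x} = {(x', y). \<exists>x. x' = phi x \<and> y \<in> T x}"
  proof -
    have T: "y \<in> T x \<longleftrightarrow> (\<exists>z\<in>S x. y = psi x z)" for x y using psi_image[of x] by blast
    show ?thesis unfolding T by (auto simp: f_def image_iff) blast+
  qed
  ultimately show ?thesis using that by simp
qed

end

section \<open>Local constancy of the topology type\<close>

lemma interpolate_same:
  assumes "\<And>j k. j < k \<Longrightarrow> k < n \<Longrightarrow> a j < a k"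
  shows "interpolate a a n v = v"
  using interpolate_props(3)[where a = a and b = a and n = n and M = 0 and v = v] assms by auto

lemma poly_tends_compose:
  assumes "poly_tends f p V" "filterlim g V U"
  shows "poly_tends (\<lambda>u. f (g u)) p U"
  using assms unfolding poly_tends_def
  by (auto intro: filterlim_compose eventually_compose_filterlim)

context equisingular_family
begin

definition curve_at :: "'q \<Rightarrow> (real \<times> real) set" where
  "curve_at q = {(x, y). poly (P q (of_real x)) (of_real y) = 0}"

abbreviation crit :: "'q \<Rightarrow> nat \<Rightarrow> real" where
  "crit q \<equiv> nth_elem (real_roots (m q))"

abbreviation ncrit :: "'q \<Rightarrow> nat" where
  "ncrit q \<equiv> card (real_roots (m q))"

definition phi :: "'q \<Rightarrow> 'q \<Rightarrow> real \<Rightarrow> real" where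
  "phi p q = interpolate (crit p) (crit q) (ncrit p)"

text \<open>The curve at \<open>q\<close> is pulled back along \<open>phi\<close>, so that both
  curves have their critical values at those of \<open>p\<close> and can be compared over the same
  \<open>x\<close>.\<close>

abbreviation fibre :: "'q \<Rightarrow> 'q \<Rightarrow> real \<Rightarrow> real set" where
  "fibre p q x \<equiv> real_roots (P q (of_real (phi p q x)))"

lemma crit_less: "j < k \<Longrightarrow> k < ncrit q \<Longrightarrow> crit q j < crit q k"
  by (rule nth_elem_less)

lemma crit_image: "q \<in> L \<Longrightarrow> crit q ` {..<ncrit q} = real_roots (m q)"
  by (intro nth_elem_image finite_real_part finite_roots_m)

lemma nhds_in_L: "q \<in> L \<Longrightarrow> nhds_in q L = nhds q"
  using open_L by (simp add: inf_absorb1 le_principal eventually_nhds_in_open)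

lemma m_tends: "q \<in> L \<Longrightarrow> poly_tends m (m q) (nhds q)"
  using poly_family_tends[OF m_family] nhds_in_L by metis

lemma P_tends: "q \<in> L \<Longrightarrow> poly_tends (\<lambda>(q, x). P q x) (P q x) (nhds (q, x))"
proof -
  assume q: "q \<in> L"
  have "open (L \<times> (UNIV :: complex set))" using open_L by (simp add: open_Times)
  then have "nhds_in (q, x) (L \<times> UNIV) = nhds (q, x)"
    using q by (simp add: inf_absorb1 le_principal eventually_nhds_in_open del: mem_Times_iff) 
  then show ?thesis using poly_family_tends[OF P_family, of "(q, x)"] q by simp
qed

lemma crit_locally:
  assumes "q \<in> L"
  shows "\<forall>\<^sub>F q' in nhds q. ncrit q' = ncrit q"
    "k < ncrit q \<Longrightarrow> ((\<lambda>q'. crit q' k) \<longlongrightarrow> crit q k) (nhds q)"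
proof -
  have "\<forall>\<^sub>F q' in nhds q. q' \<in> L" using open_L assms by (rule eventually_nhds_in_open)
  then have ev: "\<forall>\<^sub>F q' in nhds q. rsquarefree (m q') \<and> real_coeffs (m q')"
    by eventually_elim (simp add: m_simple m_real)
  show "\<forall>\<^sub>F q' in nhds q. ncrit q' = ncrit q"
    by (rule poly_tends_nth_real_root(1)[OF m_tends[OF assms] m_simple[OF assms] ev])
  show "k < ncrit q \<Longrightarrow> ((\<lambda>q'. crit q' k) \<longlongrightarrow> crit q k) (nhds q)"
    by (rule poly_tends_nth_real_root(2)[OF m_tends[OF assms] m_simple[OF assms] ev])
qed

lemma phi_at_p: "phi p p x = x"
  unfolding phi_def by (rule interpolate_same) (rule crit_less)

lemma phi_props:
  assumes n: "ncrit q = ncrit p"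
  shows "strict_mono (phi p q)" "k < ncrit p \<Longrightarrow> phi p q (crit p k) = crit q k"
    "0 \<le> M \<Longrightarrow> (\<And>k. k < ncrit p \<Longrightarrow> \<bar>crit q k - crit p k\<bar> \<le> M) \<Longrightarrow> \<bar>phi p q x - x\<bar> \<le> M"
    "continuous_on UNIV (phi p q)" "surj (phi p q)"
proof -
  have lt: "j < k \<Longrightarrow> k < ncrit p \<Longrightarrow> crit p j < crit p k"
     "j < k \<Longrightarrow> k < ncrit p \<Longrightarrow> crit q j < crit q k" for j k
    using crit_less n by auto
  show "strict_mono (phi p q)" unfolding phi_def by (rule interpolate_props(1)[OF lt])
  show "k < ncrit p \<Longrightarrow> phi p q (crit p k) = crit q k"
    unfolding phi_def by (rule interpolate_props(2)[OF lt])
  have near: "0 \<le> M \<Longrightarrow> (\<And>k. k < ncrit p \<Longrightarrow> \<bar>crit q k - crit p k\<bar> \<le> M) \<Longrightarrow> \<bar>phi p q x - x\<bar> \<le> M" for M x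
    unfolding phi_def by (rule interpolate_props(3)[OF lt])
  then show "0 \<le> M \<Longrightarrow> (\<And>k. k < ncrit p \<Longrightarrow> \<bar>crit q k - crit p k\<bar> \<le> M) \<Longrightarrow> \<bar>phi p q x - x\<bar> \<le> M" .
  show c: "continuous_on UNIV (phi p q)" unfolding phi_def
    by (rule continuous_on_interpolate[OF lt(1), of _ _ UNIV "\<lambda>v. v"]) (auto intro: continuous_on_id)
  show "surj (phi p q)"
    by (rule surj_near_identity[OF c near, of "\<Sum>k<ncrit p. \<bar>crit q k - crit p k\<bar>"])
      (auto intro!: sum_nonneg member_le_sum)
qed

lemma phi_not_critical:
  assumes n: "ncrit q = ncrit p" and L: "p \<in> L" "q \<in> L" and x: "x \<notin> real_roots (m p)"
  shows "poly (m q) (of_real (phi p q x)) \<noteq> 0"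
proof
  assume "poly (m q) (of_real (phi p q x)) = 0"
  then have "phi p q x \<in> crit q ` {..<ncrit q}" using crit_image[OF L(2)] by simp
  then obtain k where k: "k < ncrit p" "phi p q x = crit q k" using n by auto
  then have "phi p q x = phi p q (crit p k)" using phi_props(2)[OF n k(1)] by simp
  then have "x = crit p k" using strict_mono_eq[OF phi_props(1)[OF n]] by blast
  then show False using x crit_image[OF L(1)] k(1) by blast
qed

text \<open>Parameter and point may both move along the filter. A moving parameter over fixed
  \<open>x\<close> gives constancy across a ball of parameters; a moving \<open>x\<close> at fixed
  parameter gives continuity along the curve.\<close>

lemma fibre_locally:
  assumes n: "ncrit q = ncrit p" and L: "p \<in> L" "q \<in> L" and x: "x \<notin> real_roots (m p)"
    and gq: "(gq \<longlongrightarrow> q) U" and gx: "(gx \<longlongrightarrow> x) U"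
    and good: "\<forall>\<^sub>F u in U. gq u \<in> L \<and> ncrit (gq u) = ncrit p \<and> gx u \<notin> real_roots (m p)"
  shows "\<forall>\<^sub>F u in U. card (fibre p (gq u) (gx u)) = card (fibre p q x)"
    "k < card (fibre p q x) \<Longrightarrow> ((\<lambda>u. nth_elem (fibre p (gq u) (gx u)) k) \<longlongrightarrow> nth_elem (fibre p q x) k) U"
proof -
  have "((\<lambda>u. phi p (gq u) (gx u)) \<longlongrightarrow> phi p q x) U" unfolding phi_def
    using n by (intro tendsto_interpolate crit_less gx filterlim_compose[OF crit_locally(2)[OF L(2)] gq]) auto
  then have lim: "((\<lambda>u. (gq u, complex_of_real (phi p (gq u) (gx u)))) \<longlongrightarrow> (q, complex_of_real (phi p q x))) U"
    by (intro tendsto_Pair gq tendsto_of_real)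
  have t: "poly_tends (\<lambda>u. P (gq u) (of_real (phi p (gq u) (gx u)))) (P q (of_real (phi p q x))) U"
    using poly_tends_compose[OF P_tends[OF L(2)] lim] by simp
  have sq: "rsquarefree (P q (of_real (phi p q x)))"
    using L by (intro P_simple phi_not_critical n x)
  have ev: "\<forall>\<^sub>F u in U. rsquarefree (P (gq u) (of_real (phi p (gq u) (gx u)))) \<and>
      real_coeffs (P (gq u) (of_real (phi p (gq u) (gx u))))"
    using good
  proof eventually_elim
    case (elim u)
    then show ?case using phi_not_critical[of "gq u" p "gx u"] L(1) by (simp add: P_simple P_real)
  qed
  show "\<forall>\<^sub>F u in U. card (fibre p (gq u) (gx u)) = card (fibre p q x)"
    by (rule poly_tends_nth_real_root(1)[OF t sq ev])
  show "k < card (fibre p q x) \<Longrightarrow> ((\<lambda>u. nth_elem (fibre p (gq u) (gx u)) k) \<longlongrightarrow> nth_elem (fibre p q x) k) U"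
    by (rule poly_tends_nth_real_root(2)[OF t sq ev])
qed

text \<open>As \<open>q\<close> runs through the ball, the \<open>k\<close>-th root over \<open>phi p q x\<close> stays near one root over \<open>a\<close>;
  hence corresponding roots for \<open>p\<close> and \<open>q\<close> cluster at corresponding points as \<open>x \<rightarrow> a\<close>.\<close>

lemma fibre_cluster:
  assumes D: "ball p d \<subseteq> L" "\<And>q. q \<in> ball p d \<Longrightarrow> ncrit q = ncrit p"
      "\<And>q k. q \<in> ball p d \<Longrightarrow> k < ncrit p \<Longrightarrow> \<bar>crit q k - crit p k\<bar> \<le> r / 2"
    and p: "p \<in> ball p d" and q: "q \<in> ball p d" and a: "a \<in> real_roots (m p)"
    and e: "0 < e" "separated (4 * e) (roots (P p (of_real a)))"
      "\<And>z. z \<in> roots (P p (of_real a)) \<Longrightarrow> Im z \<noteq> 0 \<Longrightarrow> e \<le> \<bar>Im z\<bar>"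
    and r: "0 < r"
    and mt: "matched e (roots (P p (of_real a))) (roots (P q (of_real (phi p q a))))"
    and near: "\<And>q b y. q \<in> ball p d \<Longrightarrow> b \<in> ball (complex_of_real a) r \<Longrightarrow> poly (P q b) y = 0 \<Longrightarrow>
        \<exists>z\<in>roots (P p (of_real a)). dist y z < e"
    and card_eq: "\<And>x q. x \<notin> real_roots (m p) \<Longrightarrow> q \<in> ball p d \<Longrightarrow> card (fibre p q x) = card (fibre p p x)"
    and e': "0 < e'"
  shows "\<forall>\<^sub>F x in at a. \<forall>k<card (fibre p p x). \<exists>j<card (fibre p p a).
        \<bar>nth_elem (fibre p p x) k - nth_elem (fibre p p a) j\<bar> < e' \<and>
        \<bar>nth_elem (fibre p q x) k - nth_elem (fibre p q a) j\<bar> < e'"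
proof -
  have L: "p \<in> L" "q \<in> L" using p q D(1) by auto
  let ?Z = "roots (P p (of_real a))" and ?W = "roots (P q (of_real (phi p q a)))"
  define f where "f = min e e'"
  have f: "0 < f" "f \<le> e" "f \<le> e'" using e e' by (auto simp: f_def)
  have sep2: "separated (2 * e) ?Z" using e by (auto intro: separated_mono)
  have fin: "finite ?Z" "finite ?W" using finite_roots_P L by auto
  have mtr: "matched e (real_part ?Z) (real_part ?W)"
    using mt by (rule matched_real_part) (use e(3) in \<open>auto intro!: cnj_roots[OF P_real[OF L(2)], unfolded mem_Collect_eq]\<close>)
  note nth = nth_elem_matched[OF finite_real_part[OF fin(1)] mtr separated_real_part[OF sep2]]
  have tends: "poly_tends (\<lambda>x. P q' (of_real (phi p q' x))) (P q' (of_real (phi p q' a))) (at a)"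
    if q': "q' \<in> ball p d" for q'
  proof -
    have "isCont (phi p q') a" using phi_props(4)[OF D(2)[OF q']] by (simp add: continuous_on_eq_continuous_at)
    then have "((\<lambda>x. (q', complex_of_real (phi p q' x))) \<longlongrightarrow> (q', of_real (phi p q' a))) (at a)"
      by (intro tendsto_Pair tendsto_const tendsto_of_real) (simp add: isCont_def)
    from poly_tends_compose[OF P_tends this] show ?thesis using q' D(1) by auto
  qed
  have phi_near: "\<bar>phi p q' x - x\<bar> \<le> r / 2" if "q' \<in> ball p d" for q' x
    using r that D by (intro phi_props(3)) auto
  have e1: "\<forall>\<^sub>F x in at a. \<forall>y. poly (P p (of_real x)) y = 0 \<longrightarrow> (\<exists>z. poly (P p (of_real a)) z = 0 \<and> dist y z < f)"
    using poly_tends_roots_within[OF tends[OF p] f(1)] by (simp add: phi_at_p)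
  have e2: "\<forall>\<^sub>F x in at a. \<forall>y. poly (P q (of_real (phi p q x))) y = 0 \<longrightarrow>
      (\<exists>w. poly (P q (of_real (phi p q a))) w = 0 \<and> dist y w < f)"
    using poly_tends_roots_within[OF tends[OF q] f(1)] .
  have e3: "\<forall>\<^sub>F x in at a. \<bar>x - a\<bar> < r / 2" unfolding eventually_at dist_real_def using r by (intro exI[of _ "r / 2"]) simp
  have e4: "\<forall>\<^sub>F x in at a. x \<notin> real_roots (m p)"
    using islimpt_finite[OF finite_real_part[OF finite_roots_m[OF L(1)]], of a]
    by (auto simp: islimpt_iff_eventually)
  show ?thesis using e1 e2 e3 e4
  proof eventually_elim
    case (elim x)
    show ?case
    proof (intro allI impI)
      fix k assume k: "k < card (fibre p p x)"
      \<comment> \<open>The root of rank \<open>k\<close> over a fixed noncritical \<open>x\<close>,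
        as a function of the parameter. Simplicity makes it continuous on the ball, so it can be
        followed from \<open>p\<close> to \<open>q\<close>.\<close>
      define g where "g q' = complex_of_real (nth_elem (fibre p q' x) k)" for q'
      have root: "poly (P q' (of_real (phi p q' x))) (g q') = 0" if q': "q' \<in> ball p d" for q'
      proof -
        have fin: "finite (fibre p q' x)" using D(1) q' by (intro finite_real_part finite_roots_P) auto
        have "nth_elem (fibre p q' x) k \<in> fibre p q' x"
          using nth_elem_image[OF fin] k card_eq[OF elim(4) q'] by auto
        then show ?thesis by (simp add: g_def)
      qed
      have cont: "continuous_on (ball p d) g" unfolding g_def
      proof (intro continuous_on_of_real, unfold continuous_on_def, intro ballI)
        fix q' assume q': "q' \<in> ball p d"
        have "\<forall>\<^sub>F u in at q' within ball p d. u \<in> ball p d" by (simp add: eventually_at_filter)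
        then have "\<forall>\<^sub>F u in at q' within ball p d. u \<in> L \<and> ncrit u = ncrit p \<and> x \<notin> real_roots (m p)"
          by eventually_elim (use D elim(4) in auto)
        then show "((\<lambda>q. nth_elem (fibre p q x) k) \<longlongrightarrow> nth_elem (fibre p q' x) k) (at q' within ball p d)"
          using q' D L elim(4) k card_eq[OF elim(4) q']
          by (intro fibre_locally(2)) (auto intro: tendsto_intros)
      qed
      have cover: "\<exists>z\<in>?Z. dist (g q') z < e" if q': "q' \<in> ball p d" for q'
      proof (rule near[OF q' _ root[OF q']])
        have "\<bar>phi p q' x - a\<bar> < r" using phi_near[OF q', of x] elim(3) by linarith
        then have "\<bar>a - phi p q' x\<bar> < r" by linarith
        then show "of_real (phi p q' x) \<in> ball (complex_of_real a) r" by (simp add: dist_real_def)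
      qed
      obtain z where z: "z \<in> ?Z" "dist (g p) z < f"
        using elim(1) root[OF p] by (auto simp: phi_at_p)
      have gq: "dist (g q) z < e"
        by (rule connected_image_in_ball[OF convex_connected[OF convex_ball] cont cover sep2 p z(1) _ q])
          (use z f in auto)
      obtain w where w: "w \<in> ?W" "dist (g q) w < f" using elim(2) root[OF q] by auto
      obtain z1 where z1: "z1 \<in> ?Z" "dist w z1 < e" using mt w(1) unfolding matched_def by blast
      \<comment> \<open>The chain from \<open>z\<close> through \<open>g q\<close> and
        \<open>w\<close> to \<open>z1\<close> has three links shorter than \<open>e\<close>, whereas
        distinct roots over \<open>a\<close> are \<open>4 * e\<close> apart.\<close>
      have "dist z z1 < 4 * e"
        using gq w(2) z1(2) f(2) e(1) dist_triangle[of z z1 w] dist_triangle[of z w "g q"]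
        by (simp add: dist_commute)
      then have "z1 = z" using e(2) z(1) z1(1) unfolding separated_def by fastforce
      then have wz: "dist w z < e" using z1 by simp
      \<comment> \<open>A real root is within \<open>e\<close> of \<open>z\<close>, and nonreal
        roots over \<open>a\<close> are at least \<open>e\<close> away from the axis; so
        \<open>z\<close> is real and has a rank \<open>j\<close>.\<close>
      have "\<bar>Im z\<bar> \<le> dist (g p) z" using abs_Im_le_cmod[of "g p - z"] by (simp add: dist_norm g_def)
      then have "Im z = 0" using e(3)[OF z(1)] z(2) f(2) by linarith
      then have zs: "z = of_real (Re z)" by (simp add: complex_eq_iff)
      have "complex_of_real (Re z) \<in> ?Z" using z(1) by (subst (asm) zs)
      then have "Re z \<in> nth_elem (real_part ?Z) ` {..<card (real_part ?Z)}"
        unfolding nth_elem_image[OF finite_real_part[OF fin(1)]] by simp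
      then obtain j where j: "j < card (real_part ?Z)" "nth_elem (real_part ?Z) j = Re z" by auto
      let ?t = "nth_elem (real_part ?W) j"
      have t: "?t \<in> real_part ?W" "\<bar>?t - Re z\<bar> < e"
        using nth_elem_image[OF finite_real_part[OF fin(2)]] nth(1) nth(2)[OF j(1)] j by auto
      have "dist (complex_of_real ?t) z < e" using t(2) by (subst zs) (simp only: dist_of_real dist_real_def)
      moreover have "complex_of_real ?t \<in> ?W" using t(1) by blast
      \<comment> \<open>Both \<open>w\<close> and the real root of rank \<open>j\<close> over
        \<open>q\<close> are within \<open>e\<close> of \<open>z\<close>; uniqueness in the matching
        identifies them.\<close>
      ultimately have wt: "w = of_real ?t" using mt z(1) w(1) wz unfolding matched_def by blast
      have "\<bar>nth_elem (fibre p p x) k - Re z\<bar> < f"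
        using z(2) by (subst (asm) zs) (simp only: g_def dist_of_real dist_real_def)
      moreover have "\<bar>nth_elem (fibre p q x) k - ?t\<bar> < f"
        using w(2) unfolding wt by (simp only: g_def dist_of_real dist_real_def)
      ultimately show "\<exists>j<card (fibre p p a).
          \<bar>nth_elem (fibre p p x) k - nth_elem (fibre p p a) j\<bar> < e' \<and>
          \<bar>nth_elem (fibre p q x) k - nth_elem (fibre p q a) j\<bar> < e'"
        using j f(3) by (intro exI[of _ j]) (simp add: phi_at_p)
    qed
  qed
qed

lemma locally_same_type:
  assumes p: "p \<in> L"
  obtains d where "0 < d" "ball p d \<subseteq> L" "\<And>q. q \<in> ball p d \<Longrightarrow> same_topology_type (curve_at p) (curve_at q)"
proof -
  let ?n = "ncrit p"
  let ?Z = "\<lambda>k. roots (P p (of_real (crit p k)))"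
  define Q where "Q k e d r \<longleftrightarrow> 0 < e \<and> separated (4 * e) (?Z k) \<and> (\<forall>z\<in>?Z k. Im z \<noteq> 0 \<longrightarrow> e \<le> \<bar>Im z\<bar>) \<and>
     0 < d \<and> 0 < r \<and> ball p d \<subseteq> L \<and>
     (\<forall>q b. q \<in> ball p d \<longrightarrow> b \<in> ball (of_real (crit p k)) r \<longrightarrow> poly (m q) b = 0 \<longrightarrow> matched e (?Z k) (roots (P q b))) \<and>
     (\<forall>q b y. q \<in> ball p d \<longrightarrow> b \<in> ball (of_real (crit p k)) r \<longrightarrow> poly (P q b) y = 0 \<longrightarrow> (\<exists>z\<in>?Z k. dist y z < e))" for k e d r
  have "\<exists>e d r. Q k e d r" if k: "k < ?n" for k
  proof -
    obtain e0 where e0: "0 < e0" "separated e0 (?Z k)" "\<And>z. z \<in> ?Z k \<Longrightarrow> Im z \<noteq> 0 \<Longrightarrow> e0 \<le> \<bar>Im z\<bar>"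
      using ex_separated[OF finite_roots_P[OF p]] by metis
    define e where "e = e0 / 4"
    have e: "0 < e" "separated (4 * e) (?Z k)" "separated (2 * e) (?Z k)"
      using e0(1,2) separated_mono[OF e0(2), of "2 * e"] by (auto simp: e_def)
    have nonreal: "e \<le> \<bar>Im z\<bar>" if "z \<in> ?Z k" "Im z \<noteq> 0" for z
      using e0(3)[OF that] e0(1) by (simp add: e_def)
    have "crit p k \<in> real_roots (m p)" using crit_image[OF p] k by blast
    then have "poly (m p) (of_real (crit p k)) = 0" by simp
    then show ?thesis
    proof (rule critical_matched[OF p _ e(1,3)])
      fix d r assume "0 < d" "0 < r" "ball p d \<subseteq> L"
        "\<And>q b. q \<in> ball p d \<Longrightarrow> b \<in> ball (of_real (crit p k)) r \<Longrightarrow> poly (m q) b = 0 \<Longrightarrow> matched e (?Z k) (roots (P q b))"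
        "\<And>q b y. q \<in> ball p d \<Longrightarrow> b \<in> ball (of_real (crit p k)) r \<Longrightarrow> poly (P q b) y = 0 \<Longrightarrow> \<exists>z\<in>?Z k. dist y z < e"
      then show ?thesis unfolding Q_def using e(1,2) nonreal
        by (intro exI[of _ e] exI[of _ d] exI[of _ r] conjI allI impI ballI) simp_all
    qed
  qed
  then obtain e d r where "\<And>k. k < ?n \<Longrightarrow> Q k (e k) (d k) (r k)" by metis
  note Q = this[unfolded Q_def]
  have edr: "0 < e k" "separated (4 * e k) (?Z k)" "\<And>z. z \<in> ?Z k \<Longrightarrow> Im z \<noteq> 0 \<Longrightarrow> e k \<le> \<bar>Im z\<bar>"
     "0 < d k" "0 < r k" "ball p (d k) \<subseteq> L"
     "\<And>q b. q \<in> ball p (d k) \<Longrightarrow> b \<in> ball (of_real (crit p k)) (r k) \<Longrightarrow> poly (m q) b = 0 \<Longrightarrow>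
        matched (e k) (?Z k) (roots (P q b))"
     "\<And>q b y. q \<in> ball p (d k) \<Longrightarrow> b \<in> ball (of_real (crit p k)) (r k) \<Longrightarrow> poly (P q b) y = 0 \<Longrightarrow>
        \<exists>z\<in>?Z k. dist y z < e k"
    if "k < ?n" for k
    by (use Q[OF that] in blast)+
  \<comment> \<open>One radius for all critical values, with 1 covering the case that there are
    none. Moving them by less than \<open>r0 / 2\<close> moves every \<open>x\<close> under
    \<open>phi\<close> by at most \<open>r0 / 2\<close>, so points near a critical value stay in the
    disc where the matching is known.\<close>
  define r0 where "r0 = Min (insert 1 (r ` {..<?n}))"
  define d0 where "d0 = Min (insert 1 (d ` {..<?n}))"
  have r0: "0 < r0" "\<And>k. k < ?n \<Longrightarrow> r0 \<le> r k" unfolding r0_def using edr(5) by auto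
  have d0: "0 < d0" "\<And>k. k < ?n \<Longrightarrow> d0 \<le> d k" unfolding d0_def using edr(4) by auto
  have "\<forall>\<^sub>F q in nhds p. \<forall>k\<in>{..<?n}. dist (crit q k) (crit p k) < r0 / 2"
    using r0(1) crit_locally(2)[OF p] by (intro eventually_ball_finite ballI tendstoD) auto
  moreover have "\<forall>\<^sub>F q in nhds p. q \<in> L" using open_L p by (rule eventually_nhds_in_open)
  ultimately have "\<forall>\<^sub>F q in nhds p. q \<in> L \<and> ncrit q = ?n \<and> (\<forall>k\<in>{..<?n}. dist (crit q k) (crit p k) < r0 / 2)"
    using crit_locally(1)[OF p] by eventually_elim auto
  then obtain d1 where d1: "0 < d1"
    "\<forall>q. dist q p < d1 \<longrightarrow> q \<in> L \<and> ncrit q = ?n \<and> (\<forall>k\<in>{..<?n}. dist (crit q k) (crit p k) < r0 / 2)"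
    unfolding eventually_nhds_metric by (elim exE conjE)
  define D where "D = min d0 d1"
  have Dp: "0 < D" "p \<in> ball p D" using d0(1) d1(1) by (auto simp: D_def)
  have D: "ball p D \<subseteq> L" "\<And>q. q \<in> ball p D \<Longrightarrow> ncrit q = ?n"
    "\<And>q k. q \<in> ball p D \<Longrightarrow> k < ?n \<Longrightarrow> \<bar>crit q k - crit p k\<bar> < r0 / 2"
    using d1(2) by (auto simp: D_def dist_commute dist_real_def)
  have Dk: "ball p D \<subseteq> ball p (d k)" if "k < ?n" for k using d0(2)[OF that] by (auto simp: D_def)
  \<comment> \<open>Over a fixed noncritical \<open>x\<close> the number of real roots is locally
    constant in the parameter, hence constant on the connected ball.\<close>
  have regular: "card (fibre p q x) = card (fibre p p x)" if x: "x \<notin> real_roots (m p)" and q: "q \<in> ball p D" for x q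
  proof (rule connected_local_const[OF convex_connected[OF convex_ball] q Dp(2)], intro ballI)
    fix q' assume q': "q' \<in> ball p D"
    have "\<forall>\<^sub>F u in at q' within ball p D. u \<in> ball p D" by (simp add: eventually_at_filter)
    then have "\<forall>\<^sub>F u in at q' within ball p D. u \<in> L \<and> ncrit u = ncrit p \<and> x \<notin> real_roots (m p)"
      by eventually_elim (use D x in auto)
    then have "\<forall>\<^sub>F u in at q' within ball p D. card (fibre p u x) = card (fibre p q' x)"
      using q' D p x by (intro fibre_locally(1)) (auto intro: tendsto_intros)
    then show "\<forall>\<^sub>F u in at q' within ball p D. card (fibre p q' x) = card (fibre p u x)"
      by eventually_elim simp
  qed
  show ?thesis
  proof (rule that[OF Dp(1) D(1)])
    fix q assume q: "q \<in> ball p D"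
    have L: "q \<in> L" and n: "ncrit q = ?n" using D q by auto
    have mt: "matched (e k) (?Z k) (roots (P q (of_real (phi p q (crit p k)))))" if k: "k < ?n" for k
    proof (rule edr(7)[OF k])
      show "q \<in> ball p (d k)" using Dk[OF k] q by blast
      have pk: "phi p q (crit p k) = crit q k" by (rule phi_props(2)[OF n k])
      have "\<bar>crit p k - crit q k\<bar> < r k" using D(3)[OF q k] r0(1) r0(2)[OF k] by linarith
      then show "of_real (phi p q (crit p k)) \<in> ball (complex_of_real (crit p k)) (r k)"
        unfolding pk by (simp add: dist_real_def)
      have "crit q k \<in> real_roots (m q)" using crit_image[OF L] k n by auto
      then show "poly (m q) (of_real (phi p q (crit p k))) = 0" unfolding pk by simp
    qed
    have A: "\<exists>k<?n. a = crit p k" if "a \<in> real_roots (m p)" for a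
    proof -
      have "a \<in> crit p ` {..<?n}" unfolding crit_image[OF p] by (fact that)
      then show ?thesis by auto
    qed
    have near_p: "\<forall>\<^sub>F y in nhds x. p \<in> L \<and> ncrit p = ncrit p \<and> y \<notin> real_roots (m p)"
      and near_q: "\<forall>\<^sub>F y in nhds x. q \<in> L \<and> ncrit q = ncrit p \<and> y \<notin> real_roots (m p)"
      if x: "x \<notin> real_roots (m p)" for x
    proof -
      have "open (- real_roots (m p))"
        by (intro open_Compl finite_imp_closed finite_real_part finite_roots_m p)
      then have "\<forall>\<^sub>F y in nhds x. y \<in> - real_roots (m p)" using x by (intro eventually_nhds_in_open) auto
      then show "\<forall>\<^sub>F y in nhds x. p \<in> L \<and> ncrit p = ncrit p \<and> y \<notin> real_roots (m p)"
        "\<forall>\<^sub>F y in nhds x. q \<in> L \<and> ncrit q = ncrit p \<and> y \<notin> real_roots (m p)"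
        by (eventually_elim, use p L n in simp)+
    qed
    interpret fibrewise_match "real_roots (m p)" "fibre p p" "fibre p q"
    proof
      show "finite (real_roots (m p))" by (intro finite_real_part finite_roots_m p)
      fix x
      show "finite (fibre p p x)" "finite (fibre p q x)" by (intro finite_real_part finite_roots_P p L)+
      show "card (fibre p p x) = card (fibre p q x)"
      proof (cases "x \<in> real_roots (m p)")
        case True
        then obtain k where k: "k < ?n" "x = crit p k" using A by blast
        let ?W = "roots (P q (of_real (phi p q (crit p k))))"
        have sep: "separated (2 * e k) (?Z k)" using edr(1,2)[OF k(1)] by (auto intro: separated_mono)
        have "matched (e k) (real_part (?Z k)) (real_part ?W)"
          by (rule matched_real_part[OF mt[OF k(1)] cnj_roots[OF P_real[OF L]] edr(3)[OF k(1)]])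
        from nth_elem_matched(1)[OF finite_real_part[OF finite_roots_P[OF p]] this separated_real_part[OF sep]]
        show ?thesis unfolding k(2) by (simp add: phi_at_p)
      qed (use regular q in simp)
    next
      fix x assume x: "x \<notin> real_roots (m p)"
      show "\<forall>\<^sub>F y in nhds x. card (fibre p p y) = card (fibre p p x)"
        by (rule fibre_locally(1)[OF refl p p x tendsto_const filterlim_ident near_p[OF x]])
    next
      fix x k assume x: "x \<notin> real_roots (m p)" and k: "k < card (fibre p p x)"
      show "((\<lambda>y. nth_elem (fibre p p y) k) \<longlongrightarrow> nth_elem (fibre p p x) k) (nhds x)"
        by (rule fibre_locally(2)[OF refl p p x tendsto_const filterlim_ident near_p[OF x] k])
      have "k < card (fibre p q x)" using k regular[OF x q] by simp
      then show "((\<lambda>y. nth_elem (fibre p q y) k) \<longlongrightarrow> nth_elem (fibre p q x) k) (nhds x)"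
        by (rule fibre_locally(2)[OF n p L x tendsto_const filterlim_ident near_q[OF x]])
    next
      fix a e' :: real assume a: "a \<in> real_roots (m p)" and e': "0 < e'"
      obtain k where k: "k < ?n" "a = crit p k" using A[OF a] by blast
      show "\<forall>\<^sub>F x in at a. \<forall>k<card (fibre p p x). \<exists>j<card (fibre p p a).
        \<bar>nth_elem (fibre p p x) k - nth_elem (fibre p p a) j\<bar> < e' \<and>
        \<bar>nth_elem (fibre p q x) k - nth_elem (fibre p q a) j\<bar> < e'"
      proof (rule fibre_cluster[OF D(1,2) _ Dp(2) q a _ _ _ edr(5)[OF k(1)] _ _ regular e', of "e k"])
        show "\<bar>crit q' k' - crit p k'\<bar> \<le> r k / 2" if "q' \<in> ball p D" "k' < ?n" for q' k'
          using D(3)[OF that] r0(2)[OF k(1)] by linarith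
        show "0 < e k" "separated (4 * e k) (roots (P p (of_real a)))"
          "\<And>z. z \<in> roots (P p (of_real a)) \<Longrightarrow> Im z \<noteq> 0 \<Longrightarrow> e k \<le> \<bar>Im z\<bar>"
          using edr(1-3)[OF k(1)] unfolding k(2) by blast+
        show "matched (e k) (roots (P p (of_real a))) (roots (P q (of_real (phi p q a))))"
          using mt[OF k(1)] unfolding k(2) .
        show "\<exists>z\<in>roots (P p (of_real a)). dist y z < e k"
          if "q' \<in> ball p D" "b \<in> ball (complex_of_real a) (r k)" "poly (P q' b) y = 0" for q' b y
          using edr(8)[OF k(1) _ _ that(3)] that(1,2) Dk[OF k(1)] unfolding k(2) by blast
      qed
    qed
    obtain f g where fg: "homeomorphism UNIV UNIV f g"
      "f ` {(x, y). y \<in> fibre p p x} = {(x', y). \<exists>x. x' = phi p q x \<and> y \<in> fibre p q x}"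
      using homeomorphism_of_plane[of "phi p q"] phi_props(4,5)[OF n] strict_mono_imp_inj_on[OF phi_props(1)[OF n]]
      by blast
    have "{(x, y). y \<in> fibre p p x} = curve_at p" by (simp add: curve_at_def phi_at_p)
    moreover have "{(x', y). \<exists>x. x' = phi p q x \<and> y \<in> fibre p q x} = curve_at q"
      using phi_props(5)[OF n] unfolding curve_at_def by (auto simp: surj_def)
    ultimately show "same_topology_type (curve_at p) (curve_at q)"
      using fg unfolding same_topology_type_def by metis
  qed
qed

end

section \<open>From neighbourhoods to connected components\<close>

lemma same_topology_type_sym: "same_topology_type A B \<Longrightarrow> same_topology_type B A"
proof -
  assume "same_topology_type A B"
  then obtain f g where fg: "homeomorphism UNIV UNIV f g" "f ` A = B" unfolding same_topology_type_def by blast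
  have "g ` B = (\<lambda>x. g (f x)) ` A" unfolding fg(2)[symmetric] image_image ..
  also have "\<dots> = A" using homeomorphism_apply1[OF fg(1)] by simp
  finally show ?thesis using homeomorphism_symD[OF fg(1)] unfolding same_topology_type_def by blast
qed

lemma same_topology_type_trans:
  assumes "same_topology_type A B" "same_topology_type B C"
  shows "same_topology_type A C"
proof -
  obtain f f' g g' where fg: "homeomorphism UNIV UNIV f f'" "f ` A = B" "homeomorphism UNIV UNIV g g'" "g ` B = C"
    using assms unfolding same_topology_type_def by metis
  have "homeomorphism UNIV UNIV (g \<circ> f) (f' \<circ> g')" using fg(1,3) by (rule homeomorphism_compose)
  moreover have "(g \<circ> f) ` A = C" unfolding image_comp[symmetric] fg(2,4) by (rule refl)
  ultimately show ?thesis unfolding same_topology_type_def by blast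
qed

lemma (in equisingular_family) same_type_on_component:
  assumes p: "p \<in> L" and q: "q \<in> connected_component_set L p"
  shows "same_topology_type (curve_at p) (curve_at q)"
proof -
  let ?C = "connected_component_set L p"
  have C: "?C \<subseteq> L" by (rule connected_component_subset)
  show ?thesis
  proof (rule connected_equivalence_relation[of ?C p q "\<lambda>p q. same_topology_type (curve_at p) (curve_at q)"])
    fix a assume a: "a \<in> ?C"
    then obtain d where d: "0 < d" "\<And>q. q \<in> ball a d \<Longrightarrow> same_topology_type (curve_at a) (curve_at q)"
      using locally_same_type[of a] C by (metis subsetD)
    show "\<exists>T. openin (top_of_set ?C) T \<and> a \<in> T \<and> (\<forall>x\<in>T. same_topology_type (curve_at a) (curve_at x))"
      using a d by (intro exI[of _ "?C \<inter> ball a d"]) (auto intro: openin_open_Int)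
  qed (use p q in \<open>auto intro: same_topology_type_sym same_topology_type_trans\<close>)
qed

section \<open>Specialisation of the polynomials\<close>

text \<open>Parameters stay real, but values are taken in the complex numbers, since roots and
  circles around critical values live there.\<close>

definition evc :: "real \<times> real \<Rightarrow> real poly poly \<Rightarrow> complex" where
  "evc q c = of_real (eval_ts c (fst q) (snd q))"

lemma evc_hom: "comm_ring_hom (evc q)"
  by standard (auto simp: evc_def eval_ts_def)

lemma comm_ring_hom_poly_map:
  assumes "comm_ring_hom h"
  shows "comm_ring_hom (\<lambda>c. poly (map_poly h c) x)"
proof -
  interpret comm_ring_hom h by fact
  have mult: "map_poly h (p * q) = map_poly h p * map_poly h q" for p q
    by (rule poly_eqI) (simp add: coeff_mult hom_sum hom_mult)
  show ?thesis by standard (auto simp: hom_distribs mult)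
qed

lemma continuous_on_evc: "continuous_on UNIV (\<lambda>q. evc q c)"
proof -
  have "eval_ts c t s = (\<Sum>i\<le>degree c. poly (coeff c i) s * t ^ i)" for t s
    by (simp add: eval_ts_def poly_altdef[of c] poly_sum poly_power)
  then show ?thesis unfolding evc_def by (auto intro!: continuous_intros)
qed

definition spec_x :: "real poly poly poly \<Rightarrow> real \<times> real \<Rightarrow> complex poly" where
  "spec_x M q = map_poly (evc q) M"

definition spec_y :: "real poly poly poly poly \<Rightarrow> real \<times> real \<Rightarrow> complex \<Rightarrow> complex poly" where
  "spec_y F q x = map_poly (\<lambda>c. poly (spec_x c q) x) F"

lemma spec_x_hom: "comm_ring_hom (\<lambda>c. poly (spec_x c q) x)"
  unfolding spec_x_def by (rule comm_ring_hom_poly_map[OF evc_hom])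

lemma coeff_spec_x: "coeff (spec_x M q) i = evc q (coeff M i)"
proof -
  interpret comm_ring_hom "evc q" by (rule evc_hom)
  show ?thesis by (simp add: spec_x_def)
qed

lemma coeff_spec_y: "coeff (spec_y F q x) i = poly (spec_x (coeff F i) q) x"
proof -
  interpret comm_ring_hom "\<lambda>c. poly (spec_x c q) x" by (rule spec_x_hom)
  show ?thesis by (simp add: spec_y_def)
qed

lemma poly_spec_x: "poly (spec_x c q) x = (\<Sum>i\<le>degree c. evc q (coeff c i) * x ^ i)"
proof -
  have "degree (spec_x c q) \<le> degree c" unfolding spec_x_def by (rule degree_map_poly_le)
  then have "poly (spec_x c q) x = (\<Sum>i\<le>degree c. coeff (spec_x c q) i * x ^ i)"
    unfolding poly_altdef by (intro sum.mono_neutral_left) (auto simp: coeff_eq_0)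
  then show ?thesis by (simp add: coeff_spec_x)
qed

lemma eval_xyts_spec:
  "poly (spec_y F (t, s) (of_real x)) (of_real y) = of_real (eval_xyts F x y t s)"
proof -
  interpret e: comm_ring_hom "evc (t, s)" by (rule evc_hom)
  interpret h: comm_ring_hom "\<lambda>c. poly (spec_x c (t, s)) (of_real x)" by (rule spec_x_hom)
  have x: "poly (spec_x c (t, s)) (of_real x) = evc (t, s) (poly c [:[:x:]:])" for c
    using e.poly_map_poly[of c "[:[:x:]:]"] by (simp add: spec_x_def evc_def eval_ts_def)
  have "poly (spec_x [:[:[:y:]:]:] (t, s)) (of_real x) = of_real y"
    unfolding x by (simp add: evc_def eval_ts_def)
  then have "poly (spec_y F (t, s) (of_real x)) (of_real y) = poly (spec_x (poly F [:[:[:y:]:]:]) (t, s)) (of_real x)"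
    using h.poly_map_poly[of F "[:[:[:y:]:]:]"] by (simp add: spec_y_def)
  also have "\<dots> = of_real (eval_xyts F x y t s)"
    unfolding x by (simp add: evc_def eval_ts_def eval_xyts_def)
  finally show ?thesis .
qed

text \<open>Both discriminants act in the same way: \<open>R\<close> nonzero at \<open>q\<close>
  gives \<open>M\<close> its full degree and simple roots, and \<open>M\<close> nonzero at
  \<open>(q, x)\<close> makes the discriminant of \<open>F\<close> nonzero and so gives simple roots
  in \<open>y\<close>.\<close>

lemma equisingular_family_of_discriminant:
  fixes F :: "real poly poly poly poly"
  assumes lc: "degree (lead_coeff F) = 0" and R: "R_of F \<noteq> 0"
  shows "equisingular_family (UNIV - {(t, s). eval_ts (R_of F) t s = 0}) (spec_x (M_of F)) (spec_y F)"
proof -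
  let ?L = "UNIV - {(t, s). eval_ts (R_of F) t s = 0}"
  note Rn = R_of_nonzero[OF R]
  obtain K where K: "Dres F dvd M_of F ^ K" using Rn(4) by blast
  have R_eq: "R_of F = Dres (M_of F)" using Rn(2) by (simp add: R_of_def)
  have L: "q \<in> ?L \<longleftrightarrow> evc q (Dres (M_of F)) \<noteq> 0" for q
    by (cases q) (simp add: evc_def R_eq)
  have lcM: "evc q (lead_coeff (M_of F)) \<noteq> 0" if "q \<in> ?L" for q
    using hom_lead_coeff_nonzero[OF evc_hom Rn(2)] that L by blast
  have degM: "degree (spec_x (M_of F) q) = degree (M_of F)" if "q \<in> ?L" for q
  proof (rule antisym)
    show "degree (M_of F) \<le> degree (spec_x (M_of F) q)"
      by (rule le_degree) (simp add: coeff_spec_x lcM[OF that])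
  qed (simp add: spec_x_def degree_map_poly_le)
  have M0: "spec_x (M_of F) q \<noteq> 0" if "q \<in> ?L" for q
    using degM[OF that] Rn(2) by auto
  have D: "poly (spec_x (Dres F) q) x \<noteq> 0" if "poly (spec_x (M_of F) q) x \<noteq> 0" for q x
  proof
    interpret comm_ring_hom "\<lambda>c. poly (spec_x c q) x" by (rule spec_x_hom)
    assume "poly (spec_x (Dres F) q) x = 0"
    then have "poly (spec_x (M_of F ^ K) q) x = 0" using hom_dvd[OF K] by simp
    then show False using that by (simp add: hom_power)
  qed
  have simple: "rsquarefree (spec_y F q x)" if "poly (spec_x (M_of F) q) x \<noteq> 0" for q x
    using hom_Dres_simple_roots[OF spec_x_hom Rn(1) D[OF that]] unfolding rsquarefree_roots spec_y_def by blast
  obtain l where l: "lead_coeff F = [:l:]" using lc by (rule degree_eq_zeroE)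
  \<comment> \<open>Nonvanishing of the discriminant yields this at one noncritical \<open>x\<close>
    only; as the leading coefficient does not involve \<open>x\<close>, this suffices for all
    \<open>x\<close>.\<close>
  have lcF: "evc q l \<noteq> 0" if q: "q \<in> ?L" for q
  proof -
    obtain x where x: "poly (spec_x (M_of F) q) x \<noteq> 0" using M0[OF q] by (metis poly_all_0_iff_0)
    have "poly (spec_x (lead_coeff F) q) x \<noteq> 0"
      by (rule hom_lead_coeff_nonzero[OF spec_x_hom Rn(1) D[OF x]])
    then show ?thesis unfolding l by (simp add: poly_spec_x)
  qed
  have degF: "degree (spec_y F q x) = degree F" if "q \<in> ?L" for q x
  proof (rule antisym)
    show "degree F \<le> degree (spec_y F q x)"
      by (rule le_degree) (simp add: coeff_spec_y l poly_spec_x lcF[OF that])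
  qed (simp add: spec_y_def degree_map_poly_le)
  have real_evc: "evc q c \<in> \<real>" for q c by (simp add: evc_def)
  show ?thesis
  proof
    have "?L = (\<lambda>q. evc q (R_of F)) -` (- {0})" by (auto simp: evc_def)
    moreover have "open ((\<lambda>q. evc q (R_of F)) -` (- {0}))"
      using continuous_on_evc by (intro open_vimage) auto
    ultimately show "open ?L" by simp
    show "poly_family ?L (spec_x (M_of F))"
      unfolding poly_family_def coeff_spec_x
      using degM M0 continuous_on_subset[OF continuous_on_evc] by (intro conjI allI ballI) simp_all
    have "poly_family (?L \<times> UNIV) (\<lambda>u. spec_y F (fst u) (snd u))"
      unfolding poly_family_def
    proof (intro conjI allI ballI)
      have "continuous_on (?L \<times> UNIV) (\<lambda>u :: (real \<times> real) \<times> complex. evc (fst u) c)" for c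
        by (rule continuous_on_compose2[OF continuous_on_evc]) (auto intro: continuous_intros)
      then show "continuous_on (?L \<times> UNIV) (\<lambda>u. coeff (spec_y F (fst u) (snd u)) i)" for i
        unfolding coeff_spec_y poly_spec_x by (intro continuous_intros)
      show "degree (spec_y F (fst u) (snd u)) = degree (spec_y F (fst v) (snd v))"
        if "u \<in> ?L \<times> UNIV" "v \<in> ?L \<times> UNIV" for u v
        using degF[of "fst u" "snd u"] degF[of "fst v" "snd v"] that by (simp only: mem_Times_iff)
      show "spec_y F (fst u) (snd u) \<noteq> 0" if "u \<in> ?L \<times> UNIV" for u
      proof -
        have "degree (spec_y F (fst u) (snd u)) = degree F"
          using degF[of "fst u" "snd u"] that by (simp only: mem_Times_iff)
        then show ?thesis using Rn(1) by auto
      qed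
    qed
    then show "poly_family (?L \<times> UNIV) (\<lambda>(q, x). spec_y F q x)" by (simp add: case_prod_beta')
    fix q assume q: "q \<in> ?L"
    show "rsquarefree (spec_x (M_of F) q)"
      using hom_Dres_simple_roots[OF evc_hom Rn(2)] q L unfolding rsquarefree_roots spec_x_def by blast
    show "real_coeffs (spec_x (M_of F) q)"
      by (simp add: real_coeffs_def coeff_spec_x real_evc)
    show "(\<lambda>x. coeff (spec_y F q x) i) holomorphic_on UNIV" for i
      unfolding coeff_spec_y poly_spec_x by (intro holomorphic_intros)
    show "real_coeffs (spec_y F q (of_real t))" for t
      by (simp add: real_coeffs_def coeff_spec_y poly_spec_x real_evc)
    show "poly (spec_x (M_of F) q) x \<noteq> 0 \<Longrightarrow> rsquarefree (spec_y F q x)" for x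
      by (rule simple)
  qed
qed

theorem theorem15:
  fixes F :: "real poly poly poly poly"
  assumes "squarefree F"
    and "\<And>G. G dvd F \<Longrightarrow> only_ts G \<Longrightarrow> is_unit G"
    and "degree (lead_coeff F) = 0"
    and "R_of F \<noteq> 0"
    and "p \<in> UNIV - {(t, s). eval_ts (R_of F) t s = 0}"
    and "q \<in> connected_component_set (UNIV - {(t, s). eval_ts (R_of F) t s = 0}) p"
  shows "same_topology_type (curve F (fst p) (snd p)) (curve F (fst q) (snd q))"
proof -
  interpret equisingular_family "UNIV - {(t, s). eval_ts (R_of F) t s = 0}" "spec_x (M_of F)" "spec_y F"
    using assms(3,4) by (rule equisingular_family_of_discriminant)
  have "curve_at u = curve F (fst u) (snd u)" for u
    using eval_xyts_spec[of F "fst u" "snd u"] by (simp add: curve_at_def curve_def)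
  then show ?thesis using same_type_on_component[OF assms(5,6)] by simp
qed

end
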